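(* Let $\prec$ be a total order on the positive integers and let $(P^{\prec}_\alpha)$ be the powersum basis of $\mathrm{QSym}$ induced by $\prec$. Then for every composition $\alpha$ $$P^{\prec}_\alpha=\sum_{T^{\prec}(\alpha)\le\beta\le C^{\prec}(\alpha)}(-1)^{\mathsf{ht}(\beta,\alpha)}\,|\mathsf{SDR}(\beta,\alpha)|\,F_\beta .$$
   Context: Compositions. A composition of $n$ is a sequence of positive integers with sum $n$; it is identified with a subset of $[n-1]$ by $(a_1,\dots,a_k)\leftrightarrow\{a_1,a_1+a_2,\dots,a_1+\cdots+a_{k-1}\}$. Write $\alpha\le\beta$ if $\beta$ is obtained from $\alpha$ by summing groups of consecutive parts (as subsets, $\beta\subseteq\alpha$). $m_i(\alpha)$ is the number of parts of $\alpha$ equal to $i$. In the Hopf algebra $\mathrm{QSym}$ of quasisymmetric functions, $M_\alpha=\sum_{i_1<\cdots<i_k}x_{i_1}^{a_1}\cdots x_{i_k}^{a_k}$ and $F_\alpha=\sum_{\beta\le\alpha}M_\beta$. If $\alpha\le\beta=(b_1,\dots,b_l)$, write $\alpha$ as the concatenation $\alpha^{(1)}|\cdots|\alpha^{(l)}$ with $\alpha^{(j)}$ a composition of $b_j$; put $c_i(\alpha,\beta)!=\prod_j m_i(\alpha^{(j)})!$ and $C_{\alpha\beta}=\prod_i\frac{m_i(\alpha)!}{c_i(\alpha,\beta)!}$. The compositions $C^\prec(\alpha)$ and $T^\prec(\alpha)$. Let $\prec$ be a total order on the positive integers ($\succ$, $\succeq$ the associated relations). Break $\alpha=(a_1,\dots,a_k)$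 at its ascents according to $\prec$, that is, between $a_i$ and $a_{i+1}$ exactly when $a_i\prec a_{i+1}$; this gives $\alpha=\gamma_1|\cdots|\gamma_l$, where consecutive parts inside each run $\gamma_j$ satisfy $a_i\succeq a_{i+1}$. Then $C^{\prec}(\alpha)=(|\gamma_1|,\dots,|\gamma_l|)$, where $|\gamma_j|$ is the sum of the parts of $\gamma_j$, and $T^{\prec}(\alpha)=\gamma_1'|\cdots|\gamma_l'$, where for a composition $\gamma$ of $m$, $\gamma'$ is the composition of $m$ whose subset of $[m-1]$ is the complement of the subset of $\gamma$. Equivalently, in subset notation, $T^{\prec}(\alpha)=C^{\prec}(\alpha)\cup D^{\complement}$ with $D=\{a_1+\cdots+a_i : 1\le i<k,\ a_i\succeq a_{i+1}\}$ and $\alpha=C^\prec(\alpha)\cup D$. The basis. $P^{\prec}_\alpha=\sum_{\alpha\le\beta\le C^{\prec}(\alpha)}C_{\alpha\beta}M_\beta$. Ribbons. For $\beta=(b_1,\dots,b_l)$, $R(\beta)$ is the ribbon with rows of lengths $b_1,\dots,b_l$ from top to bottom, in which the first box of each row lies directly below the last box of the row above. Its boxes are ordered from the top-left end to the bottom-right end. $R-j$ is $R$ with its first $j$ boxes removed. Ribbons are also allowed to be disconnected, where consecutive boxes may share only a corner (the next box being diagonally southeast of the previous one). The tuple $D(\beta,\alpha)=(R_1,\dots,R_n)$ of ribbons and the integer $\mathsf{ht}(\beta,\alpha)$, for compositions $\alpha=(a_1,\dots,a_k)$ and $\beta=(b_1,\dots,b_l)$ of $n$, are produced as follows. Start with $\mathsf{ht}=0$,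 $R=R(\beta)$, and all $R_j$ empty. For $i=1,\dots,k$ in order: (1) Extend $R_{a_i}$ at its bottom-right end by one box: if $i=1$ or $a_{i-1}\ne a_i$, the box is added in the southeast position (diagonally; if $R_{a_i}$ is empty it just becomes one box); if $i>1$, $a_{i-1}=a_i$ and there is $j$ with $R=R(b_j,\dots,b_l)$, it is added in the south position (directly below the last box); if $i>1$, $a_{i-1}=a_i$ and there is no such $j$, it is added in the east position (directly right of the last box). (2) Replace $\mathsf{ht}$ by $\mathsf{ht}-1+h$, where $h$ is the number of rows occupied by the first $a_i$ boxes of $R$. (3) Replace $R$ by $R-a_i$. The final values are $D(\beta,\alpha)$ and $\mathsf{ht}(\beta,\alpha)$. $\mathsf{SDR}(\beta,\alpha)$ is the set of tuples of fillings of the ribbons in $D(\beta,\alpha)$ such that each ribbon $R_j$ with $r$ boxes is filled with each of $1,\dots,r$ exactly once, entries increasing (in the usual order) from left to right within each row and decreasing from top to bottom within each column; boxes touching only at a corner impose no condition.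
   Formalization: T^≺(α) is taken with D = {a_1+…+a_i : a_i ≻ a_{i+1}} (strict descents) instead of a_i ⪰ a_{i+1}; with weak descents the identity fails whenever two adjacent parts are equal, e.g. α=(1,1), where P = F_2+F_11 but the sum gives only F_2. *)

theory Defs
  imports Complex_Main "HOL-Library.Poly_Mapping" "HOL-Library.FuncSet"
begin

section \<open>Compositions\<close>

definition is_composition :: "nat list \<Rightarrow> bool" where
  "is_composition \<alpha> \<longleftrightarrow> 0 \<notin> set \<alpha>"

definition comp_subset :: "nat list \<Rightarrow> nat set" where
  "comp_subset \<alpha> = {sum_list (take i \<alpha>) | i. 1 \<le> i \<and> i < length \<alpha>}"

definition comp_of_subset :: "nat \<Rightarrow> nat set \<Rightarrow> nat list" where
  "comp_of_subset n S =
     (THE \<gamma>. is_composition \<gamma> \<and> sum_list \<gamma> = n \<and> comp_subset \<gamma> = S)"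

text \<open>\<open>comp_le \<alpha> \<beta>\<close>: the composition \<open>\<beta>\<close> is obtained from \<open>\<alpha>\<close> by summing groups of consecutive
  parts, so the finer composition is the smaller one.\<close>

definition comp_le :: "nat list \<Rightarrow> nat list \<Rightarrow> bool" where
  "comp_le \<alpha> \<beta> \<longleftrightarrow> is_composition \<alpha> \<and>
     (\<exists>bs. [] \<notin> set bs \<and> concat bs = \<alpha> \<and> map sum_list bs = \<beta>)"

definition comp_blocks :: "nat list \<Rightarrow> nat list \<Rightarrow> nat list list" where
  "comp_blocks \<alpha> \<beta> = (THE bs. [] \<notin> set bs \<and> concat bs = \<alpha> \<and> map sum_list bs = \<beta>)"

text \<open>The product over all \<open>i\<close> is restricted to the parts of \<open>\<alpha>\<close>; every other factor is \<open>0!/0! = 1\<close>.\<close>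

definition comp_coeff :: "nat list \<Rightarrow> nat list \<Rightarrow> 'a::field_char_0" where
  "comp_coeff \<alpha> \<beta> =
     (\<Prod>i\<in>set \<alpha>. fact (count_list \<alpha> i) / (\<Prod>b\<leftarrow>comp_blocks \<alpha> \<beta>. fact (count_list b i)))"


section \<open>Quasisymmetric functions\<close>

text \<open>A formal power series in the variables \<open>x\<^sub>0, x\<^sub>1, x\<^sub>2, \<dots>\<close> is the function that assigns
  to each monomial, given by its finitely supported exponent vector, its coefficient.\<close>

type_synonym 'a power_series = "(nat \<Rightarrow>\<^sub>0 nat) \<Rightarrow> 'a"

definition monomial_qsym :: "nat list \<Rightarrow> 'a::field_char_0 power_series" where
  "monomial_qsym \<alpha> = (\<lambda>m. of_nat (card {ix :: nat list.
     sorted_wrt (<) ix \<and> length ix = length \<alpha> \<and>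
     sum_list (map2 Poly_Mapping.single ix \<alpha>) = m}))"

definition fundamental_qsym :: "nat list \<Rightarrow> 'a::field_char_0 power_series" where
  "fundamental_qsym \<alpha> = (\<lambda>m. \<Sum>\<beta> | comp_le \<beta> \<alpha>. monomial_qsym \<beta> m)"


section \<open>The powersum basis induced by an order\<close>

fun break_at :: "('a \<Rightarrow> 'a \<Rightarrow> bool) \<Rightarrow> 'a list \<Rightarrow> 'a list list" where
  "break_at R [] = []"
| "break_at R [x] = [[x]]"
| "break_at R (x # y # zs) =
     (if R x y then [x] # break_at R (y # zs)
      else (x # hd (break_at R (y # zs))) # tl (break_at R (y # zs)))"

definition C_comp :: "(nat \<Rightarrow> nat \<Rightarrow> bool) \<Rightarrow> nat list \<Rightarrow> nat list" where
  "C_comp prec \<alpha> = map sum_list (break_at prec \<alpha>)"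

text \<open>In \<open>T_comp\<close> the descents must be strict: with weak descents
  \<open>a\<^sub>i \<succeq> a\<^sub>i\<^sub>+\<^sub>1\<close> in their place, \<open>T_comp prec [1,1]\<close> would be \<open>[2]\<close>, and the powersum
  \<open>2 M\<^sub>1\<^sub>1 + M\<^sub>2 = F\<^sub>2 + F\<^sub>1\<^sub>1\<close> of \<open>[1,1]\<close> would lose its term \<open>F\<^sub>1\<^sub>1\<close>. The two variants
  agree when no two adjacent parts are equal.\<close>

definition strict_descents :: "(nat \<Rightarrow> nat \<Rightarrow> bool) \<Rightarrow> nat list \<Rightarrow> nat set" where
  "strict_descents prec \<alpha> =
     {sum_list (take i \<alpha>) | i. 1 \<le> i \<and> i < length \<alpha> \<and> prec (\<alpha> ! i) (\<alpha> ! (i - 1))}"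

definition T_comp :: "(nat \<Rightarrow> nat \<Rightarrow> bool) \<Rightarrow> nat list \<Rightarrow> nat list" where
  "T_comp prec \<alpha> = comp_of_subset (sum_list \<alpha>)
     (comp_subset (C_comp prec \<alpha>) \<union> ({1..<sum_list \<alpha>} - strict_descents prec \<alpha>))"

definition powersum_qsym ::
  "(nat \<Rightarrow> nat \<Rightarrow> bool) \<Rightarrow> nat list \<Rightarrow> 'a::field_char_0 power_series" where
  "powersum_qsym prec \<alpha> = (\<lambda>m. \<Sum>\<beta> | comp_le \<alpha> \<beta> \<and> comp_le \<beta> (C_comp prec \<alpha>).
     comp_coeff \<alpha> \<beta> * monomial_qsym \<beta> m)"


section \<open>Ribbons\<close>

text \<open>A box is a pair (row, column), with rows numbered downwards and columns to the right. A ribbon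
  is the list of its boxes from the top-left to the bottom-right end, up to translation.\<close>

type_synonym box = "nat \<times> nat"
type_synonym ribbon = "box list"

fun ribbon_at :: "nat \<Rightarrow> nat \<Rightarrow> nat list \<Rightarrow> ribbon" where
  "ribbon_at r c [] = []"
| "ribbon_at r c (b # bs) = map (\<lambda>t. (r, c + t)) [0..<b] @ ribbon_at (r + 1) (c + b - 1) bs"

definition ribbon :: "nat list \<Rightarrow> ribbon" where
  "ribbon \<beta> = ribbon_at 0 0 \<beta>"

text \<open>Add a box displaced by \<open>(dr, dc)\<close> from the last one.\<close>

definition extend :: "nat \<Rightarrow> nat \<Rightarrow> ribbon \<Rightarrow> ribbon" where
  "extend dr dc R =
     (if R = [] then [(0, 0)] else R @ [(fst (last R) + dr, snd (last R) + dc)])"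

text \<open>The state is \<open>(ht, R, D)\<close>, where \<open>D j\<close> is the ribbon \<open>R\<^sub>j\<close>. The parts of \<open>\<alpha>\<close> are
  indexed from 0.\<close>

definition ribbon_step :: "nat list \<Rightarrow> nat list \<Rightarrow> nat \<Rightarrow>
    int \<times> ribbon \<times> (nat \<Rightarrow> ribbon) \<Rightarrow> int \<times> ribbon \<times> (nat \<Rightarrow> ribbon)" where
  "ribbon_step \<beta> \<alpha> i = (\<lambda>(ht, R, D).
     let a = \<alpha> ! i;
         R\<^sub>a = (if i = 0 \<or> \<alpha> ! (i - 1) \<noteq> a then extend 1 1 (D a)
               else if \<exists>j < length \<beta>. \<exists>r c. R = ribbon_at r c (drop j \<beta>) then extend 1 0 (D a)
               else extend 0 1 (D a));
         h = card (fst ` set (take a R))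
     in (ht - 1 + int h, drop a R, D(a := R\<^sub>a)))"

definition ribbon_run ::
  "nat list \<Rightarrow> nat list \<Rightarrow> int \<times> ribbon \<times> (nat \<Rightarrow> ribbon)" where
  "ribbon_run \<beta> \<alpha> = fold (ribbon_step \<beta> \<alpha>) [0..<length \<alpha>] (0, ribbon \<beta>, \<lambda>_. [])"

definition ribbon_ht :: "nat list \<Rightarrow> nat list \<Rightarrow> int" where
  "ribbon_ht \<beta> \<alpha> = fst (ribbon_run \<beta> \<alpha>)"

definition ribbon_tuple :: "nat list \<Rightarrow> nat list \<Rightarrow> nat \<Rightarrow> ribbon" where
  "ribbon_tuple \<beta> \<alpha> = snd (snd (ribbon_run \<beta> \<alpha>))"

text \<open>Distinct connected components of a ribbon occupy distinct rows and columns, so boxes in a common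
  row or column always belong to the same component.\<close>

definition standard_fillings :: "ribbon \<Rightarrow> (box \<Rightarrow> nat) set" where
  "standard_fillings R = {f \<in> extensional (set R).
     bij_betw f (set R) {1..length R} \<and>
     (\<forall>r c c'. (r, c) \<in> set R \<and> (r, c') \<in> set R \<and> c < c' \<longrightarrow> f (r, c) < f (r, c')) \<and>
     (\<forall>r r' c. (r, c) \<in> set R \<and> (r', c) \<in> set R \<and> r < r' \<longrightarrow> f (r, c) > f (r', c))}"

definition SDR :: "nat list \<Rightarrow> nat list \<Rightarrow> (nat \<Rightarrow> box \<Rightarrow> nat) set" where
  "SDR \<beta> \<alpha> = (\<Pi>\<^sub>E j\<in>{1..sum_list \<alpha>}. standard_fillings (ribbon_tuple \<beta> \<alpha> j))"

end

theory Submission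
  imports Defs "HOL-Library.Infinite_Set"
begin

text \<open>
  Compositions of \<open>n\<close> are replaced by their subsets of \<open>[n - 1]\<close>. Write \<open>A\<close> for the
  subset of \<open>\<alpha>\<close>, which splits into ascents \<open>C\<close>, strict descents \<open>S\<close> and equalities \<open>E\<close>.
  Expanding each \<open>F\<^sub>\<beta>\<close> into monomials and exchanging sums, the coefficient of \<open>M\<^sub>\<gamma>\<close>, where
  \<open>\<gamma>\<close> has subset \<open>G\<close> containing \<open>C\<close>, is the sum over \<open>C \<subseteq> B \<subseteq> G - S\<close> of \<open>|SDR|\<close> with sign
  given by the parity of \<open>|B - A|\<close>, because the height counts the elements of \<open>B\<close> strictly
  inside the parts of \<open>\<alpha>\<close>. The ribbon fillings only see \<open>B \<inter> E\<close>: they are families of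
  permutations, one for each part size, whose descents between adjacent equal parts lie exactly
  at \<open>B \<inter> E\<close>. If \<open>G\<close> has an element outside \<open>A\<close>, toggling it in \<open>B\<close> cancels the sum.
  Otherwise all signs are positive, and summing over \<open>B\<close> counts the families whose descents lie
  in \<open>G\<close>. Since equal parts inside a block of \<open>\<gamma>\<close> are adjacent, these are the families
  increasing on each block, and their number is the multinomial coefficient
  \<open>C\<^sub>\<alpha>\<^sub>\<gamma>\<close>.
\<close>

section \<open>Compositions as sets of partial sums\<close>

lemma comp_subset_image: "comp_subset \<alpha> = (\<lambda>i. sum_list (take i \<alpha>)) ` {1..<length \<alpha>}"
  by (auto simp: comp_subset_def)

lemma is_composition_simps [simp]:
  "is_composition []"
  "is_composition (a # \<alpha>) \<longleftrightarrow> 0 < a \<and> is_composition \<alpha>"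
  "is_composition (\<alpha> @ \<beta>) \<longleftrightarrow> is_composition \<alpha> \<and> is_composition \<beta>"
  by (auto simp: is_composition_def)

lemma comp_subset_Nil [simp]: "comp_subset [] = {}"
  by (simp add: comp_subset_image)

lemma comp_subset_Cons:
  "comp_subset (a # \<alpha>) = (if \<alpha> = [] then {} else insert a ((+) a ` comp_subset \<alpha>))"
proof (cases "\<alpha> = []")
  case False
  have "(\<lambda>i. sum_list (take i (a # \<alpha>))) ` {1..<length (a # \<alpha>)} =
      (\<lambda>i. a + sum_list (take i \<alpha>)) ` {0..<length \<alpha>}"
    unfolding One_nat_def list.size(4) add_Suc_right add_0_right image_Suc_atLeastLessThan [symmetric]
    by (simp only: image_image take_Suc_Cons sum_list.Cons)
  also have "{0..<length \<alpha>} = insert 0 {1..<length \<alpha>}" using False by (cases \<alpha>) auto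
  finally show ?thesis
    using False unfolding comp_subset_image by (simp add: image_image)
qed (simp add: comp_subset_image)

lemma comp_subset_singleton [simp]: "comp_subset [a] = {}"
  by (simp add: comp_subset_Cons)

lemma comp_subset_append:
  "\<alpha> \<noteq> [] \<Longrightarrow> \<beta> \<noteq> [] \<Longrightarrow>
   comp_subset (\<alpha> @ \<beta>) = insert (sum_list \<alpha>) (comp_subset \<alpha> \<union> (+) (sum_list \<alpha>) ` comp_subset \<beta>)"
  by (induction \<alpha>) (auto simp: comp_subset_Cons image_image image_Un add.assoc)

lemma comp_subset_snoc:
  "comp_subset (\<alpha> @ [a]) = (if \<alpha> = [] then {} else insert (sum_list \<alpha>) (comp_subset \<alpha>))"
  by (simp add: comp_subset_append comp_subset_Cons)

lemma sum_list_pos_composition: "is_composition \<alpha> \<Longrightarrow> \<alpha> \<noteq> [] \<Longrightarrow> 0 < sum_list \<alpha>"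
  by (cases \<alpha>) auto

lemma is_composition_sublists:
  "is_composition \<alpha> \<Longrightarrow> is_composition (take i \<alpha>)"
  "is_composition \<alpha> \<Longrightarrow> is_composition (drop i \<alpha>)"
  by (auto simp: is_composition_def dest: in_set_takeD in_set_dropD)

lemma partial_sum_less:
  assumes "is_composition \<alpha>" "i < j" "j \<le> length \<alpha>"
  shows "sum_list (take i \<alpha>) < sum_list (take j \<alpha>)"
proof -
  have "take j \<alpha> = take i \<alpha> @ take (j - i) (drop i \<alpha>)"
    using assms by (metis le_add_diff_inverse less_imp_le take_add)
  moreover have "0 < sum_list (take (j - i) (drop i \<alpha>))"
    using assms by (intro sum_list_pos_composition is_composition_sublists) auto
  ultimately show ?thesis by simp
qed

lemma partial_sum_inj:
  assumes "is_composition \<alpha>" "i \<le> length \<alpha>" "j \<le> length \<alpha>"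
    "sum_list (take i \<alpha>) = sum_list (take j \<alpha>)"
  shows "i = j"
  using partial_sum_less[OF assms(1)] assms by (metis less_irrefl linorder_neqE_nat)

lemma partial_sum_mono:
  assumes "i \<le> j"
  shows "sum_list (take i \<alpha>) \<le> sum_list (take j (\<alpha> :: nat list))"
proof -
  have "take j \<alpha> = take i \<alpha> @ take (j - i) (drop i \<alpha>)"
    using assms by (metis le_add_diff_inverse take_add)
  then show ?thesis by simp
qed

lemma comp_subset_bounds:
  assumes "is_composition \<alpha>"
  shows "comp_subset \<alpha> \<subseteq> {1..<sum_list \<alpha>}"
proof
  fix x assume "x \<in> comp_subset \<alpha>"
  then obtain i where "1 \<le> i" "i < length \<alpha>" "x = sum_list (take i \<alpha>)"
    by (auto simp: comp_subset_def)
  then show "x \<in> {1..<sum_list \<alpha>}"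
    using partial_sum_less[OF assms, of 0 i] partial_sum_less[OF assms, of i "length \<alpha>"] by simp
qed

lemma finite_comp_subset [simp]: "finite (comp_subset \<alpha>)"
  by (simp add: comp_subset_image)

lemma comp_subset_snoc_diff:
  assumes "is_composition \<alpha>" "\<alpha> \<noteq> []"
  shows "Max (comp_subset (\<alpha> @ [a])) = sum_list \<alpha>"
    and "comp_subset \<alpha> = comp_subset (\<alpha> @ [a]) - {sum_list \<alpha>}"
  using comp_subset_bounds[OF assms(1)] assms(2)
  by (auto simp: comp_subset_snoc intro!: Max_eqI)

text \<open>The largest element of the subset is the sum of all parts but the last. Together with
  the total it determines the last part, and removing it leaves the subset of the remaining prefix,
  to which the induction applies.\<close>

lemma comp_subset_inject:
  assumes "is_composition \<alpha>" "is_composition \<beta>" "sum_list \<alpha> = sum_list \<beta>"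
    "comp_subset \<alpha> = comp_subset \<beta>"
  shows "\<alpha> = \<beta>"
  using assms
proof (induction \<alpha> arbitrary: \<beta> rule: rev_induct)
  case Nil
  then show ?case by (metis less_irrefl sum_list.Nil sum_list_pos_composition)
next
  case (snoc a \<alpha>)
  have "\<beta> \<noteq> []" using snoc.prems by auto
  then obtain \<beta>' b where \<beta>: "\<beta> = \<beta>' @ [b]" by (meson rev_exhaust)
  show ?case
  proof (cases "\<alpha> = []")
    case True
    then have "\<beta>' = []" using snoc.prems \<beta> by (auto simp: comp_subset_snoc split: if_splits)
    with True \<beta> snoc.prems show ?thesis by simp
  next
    case False
    then have "\<beta>' \<noteq> []" using snoc.prems \<beta> by (auto simp: comp_subset_snoc)
    then have "sum_list \<alpha> = sum_list \<beta>'" "comp_subset \<alpha> = comp_subset \<beta>'"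
      using comp_subset_snoc_diff[of \<alpha> a] comp_subset_snoc_diff[of \<beta>' b] False snoc.prems \<beta>
      by auto
    moreover from this have "a = b" using snoc.prems(3) \<beta> by simp
    ultimately show ?thesis using snoc.IH[of \<beta>'] snoc.prems(1,2) \<beta> by simp
  qed
qed

text \<open>Strong induction on \<open>n\<close>: the largest element \<open>m\<close> of
  \<open>X\<close> must be the sum of all parts but the last, so a composition of \<open>m\<close>
  for the other elements is extended by the part \<open>n - m\<close>.\<close>

lemma composition_of_subset_exists:
  assumes "X \<subseteq> {1..<n}"
  shows "\<exists>\<gamma>. is_composition \<gamma> \<and> sum_list \<gamma> = n \<and> comp_subset \<gamma> = X"
  using assms
proof (induction n arbitrary: X rule: less_induct)
  case (less n)
  have fin: "finite X" using less.prems finite_subset by blast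
  consider "n = 0" | "n > 0" "X = {}" | "X \<noteq> {}" by blast
  then show ?case
  proof cases
    case 1
    then show ?thesis using less.prems by (intro exI[of _ "[]"]) auto
  next
    case 2
    then show ?thesis by (intro exI[of _ "[n]"]) (auto simp: comp_subset_Cons)
  next
    case 3
    define m where "m = Max X"
    have m: "m \<in> X" using fin 3 by (simp add: m_def)
    then have mn: "m < n" "0 < m" using less.prems by force+
    have "x \<le> m" if "x \<in> X" for x using fin that by (simp add: m_def)
    then have "X - {m} \<subseteq> {1..<m}"
      using less.prems by (force simp: less_le)
    then obtain \<gamma> where \<gamma>: "is_composition \<gamma>" "sum_list \<gamma> = m" "comp_subset \<gamma> = X - {m}"
      using less.IH mn by blast
    moreover from this(2) have "\<gamma> \<noteq> []" using mn(2) by (metis less_irrefl sum_list.Nil)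
    moreover have "insert m (X - {m}) = X" using m by blast
    ultimately show ?thesis
      using mn by (intro exI[of _ "\<gamma> @ [n - m]"]) (simp add: comp_subset_snoc)
  qed
qed

lemma comp_of_subset:
  assumes "X \<subseteq> {1..<n}"
  shows "is_composition (comp_of_subset n X)" "sum_list (comp_of_subset n X) = n"
    "comp_subset (comp_of_subset n X) = X"
proof -
  have "\<exists>!\<gamma>. is_composition \<gamma> \<and> sum_list \<gamma> = n \<and> comp_subset \<gamma> = X"
    using composition_of_subset_exists[OF assms] comp_subset_inject by blast
  from theI'[OF this]
  show "is_composition (comp_of_subset n X)" "sum_list (comp_of_subset n X) = n"
    "comp_subset (comp_of_subset n X) = X"
    by (auto simp: comp_of_subset_def)
qed

section \<open>Coarsening as inclusion of subsets, and the blocks of a coarsening\<close>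

lemma sum_list_concat: "sum_list (concat xss) = sum_list (map sum_list xss)"
  by (induction xss) auto

lemma comp_subset_coarsening:
  "[] \<notin> set bs \<Longrightarrow> comp_subset (map sum_list bs) \<subseteq> comp_subset (concat bs)"
proof (induction bs rule: rev_induct)
  case (snoc b bs)
  show ?case
  proof (cases "bs = []")
    case False
    then have "concat bs \<noteq> []" using snoc.prems by (cases bs) auto
    moreover have "b \<noteq> []" using snoc.prems by auto
    ultimately have "comp_subset (concat (bs @ [b])) = insert (sum_list (concat bs))
        (comp_subset (concat bs) \<union> (+) (sum_list (concat bs)) ` comp_subset b)"
      by (simp add: comp_subset_append)
    with False snoc show ?thesis
      by (auto simp: comp_subset_snoc sum_list_concat)
  qed (simp add: comp_subset_Cons)
qed simp

text \<open>Induction from the right: the sum of all parts of \<beta> but the last is also a partial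
  sum of \<alpha>. Cutting \<alpha> there gives the last block, and the smaller elements of the
  subset of \<beta> are partial sums of the prefix of \<alpha>.\<close>

lemma coarsening_exists:
  assumes "is_composition \<alpha>" "is_composition \<beta>" "sum_list \<alpha> = sum_list \<beta>"
    "comp_subset \<beta> \<subseteq> comp_subset \<alpha>"
  shows "\<exists>bs. [] \<notin> set bs \<and> concat bs = \<alpha> \<and> map sum_list bs = \<beta>"
  using assms
proof (induction \<beta> arbitrary: \<alpha> rule: rev_induct)
  case Nil
  then have "\<alpha> = []" using sum_list_pos_composition[of \<alpha>] by (metis less_irrefl sum_list.Nil)
  then show ?case by (intro exI[of _ "[]"]) auto
next
  case (snoc b \<beta>)
  show ?case
  proof (cases "\<beta> = []")
    case True
    with snoc.prems have "\<alpha> \<noteq> []" "sum_list \<alpha> = b" by auto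
    with True show ?thesis by (intro exI[of _ "[\<alpha>]"]) auto
  next
    case False
    then have "sum_list \<beta> \<in> comp_subset \<alpha>"
      using snoc.prems by (auto simp: comp_subset_snoc)
    then obtain i where i: "1 \<le> i" "i < length \<alpha>" "sum_list \<beta> = sum_list (take i \<alpha>)"
      by (auto simp: comp_subset_def)
    have \<alpha>: "\<alpha> = take i \<alpha> @ drop i \<alpha>" "take i \<alpha> \<noteq> []" "drop i \<alpha> \<noteq> []"
      using i by auto
    have comp: "is_composition (take i \<alpha>)" "is_composition \<beta>"
      using snoc.prems is_composition_sublists by auto
    have "comp_subset \<beta> \<subseteq> comp_subset (take i \<alpha>)"
    proof
      fix x assume "x \<in> comp_subset \<beta>"
      moreover from this have "x < sum_list (take i \<alpha>)"
        using comp_subset_bounds comp i by force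
      moreover have "comp_subset \<alpha> = insert (sum_list (take i \<alpha>))
          (comp_subset (take i \<alpha>) \<union> (+) (sum_list (take i \<alpha>)) ` comp_subset (drop i \<alpha>))"
        using comp_subset_append[OF \<alpha>(2,3)] by simp
      ultimately show "x \<in> comp_subset (take i \<alpha>)"
        using snoc.prems False by (auto simp: comp_subset_snoc)
    qed
    with snoc.IH[OF comp] i obtain bs where
      bs: "[] \<notin> set bs" "concat bs = take i \<alpha>" "map sum_list bs = \<beta>" by auto
    have "sum_list (drop i \<alpha>) = b"
      using snoc.prems(3) i \<alpha>(1) by (metis add_left_cancel sum_list.Cons sum_list.Nil sum_list_append add_0_right)
    with bs \<alpha> show ?thesis by (intro exI[of _ "bs @ [drop i \<alpha>]"]) auto
  qed
qed

text \<open>This form turns sums over intervals of compositions into sums over intervals of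
  sets.\<close>

lemma comp_le_iff:
  "comp_le \<alpha> \<beta> \<longleftrightarrow> is_composition \<alpha> \<and> is_composition \<beta> \<and> sum_list \<alpha> = sum_list \<beta> \<and>
     comp_subset \<beta> \<subseteq> comp_subset \<alpha>"
proof
  assume "comp_le \<alpha> \<beta>"
  then obtain bs where bs: "is_composition \<alpha>" "[] \<notin> set bs" "concat bs = \<alpha>" "map sum_list bs = \<beta>"
    by (auto simp: comp_le_def)
  moreover have "0 < sum_list b" if "b \<in> set bs" for b
    using that bs(1,2) unfolding bs(3)[symmetric]
    by (intro sum_list_pos_composition) (auto simp: is_composition_def)
  then have "is_composition \<beta>"
    unfolding bs(4)[symmetric] is_composition_def set_map by (metis imageE less_irrefl)
  ultimately show "is_composition \<alpha> \<and> is_composition \<beta> \<and> sum_list \<alpha> = sum_list \<beta> \<and>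
     comp_subset \<beta> \<subseteq> comp_subset \<alpha>"
    using comp_subset_coarsening[OF bs(2)] sum_list_concat[of bs] by metis
qed (auto simp: comp_le_def coarsening_exists)

text \<open>Positive parts make partial sums strictly increasing, so the sum of a prefix determines
  its length.\<close>

lemma prefix_eq_of_sum_list_eq:
  assumes "is_composition (x @ xs)" "x @ xs = y @ ys" "sum_list x = sum_list y"
  shows "x = y"
proof -
  have "length x = length y"
    using partial_sum_inj[OF assms(1), of "length x" "length y"] assms(2,3)
    by (metis append_eq_conv_conj length_append le_add1)
  with assms(2) show ?thesis by simp
qed

text \<open>The sums of the blocks determine where each block ends, one after the other. This gives
  meaning to the definite description in \<open>comp_blocks\<close>.\<close>

lemma blocks_unique:
  assumes "is_composition (concat bs)" "concat bs = concat cs" "map sum_list bs = map sum_list cs"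
  shows "bs = cs"
  using assms
proof (induction bs arbitrary: cs)
  case (Cons b bs)
  then obtain c cs' where cs: "cs = c # cs'" by (cases cs) auto
  then have "b = c"
    using prefix_eq_of_sum_list_eq[of b "concat bs" c "concat cs'"] Cons.prems
    by (simp del: is_composition_simps(3))
  with cs Cons show ?case by auto
qed simp

lemma comp_blocks:
  assumes "comp_le \<alpha> \<beta>"
  shows "[] \<notin> set (comp_blocks \<alpha> \<beta>)" "concat (comp_blocks \<alpha> \<beta>) = \<alpha>"
    "map sum_list (comp_blocks \<alpha> \<beta>) = \<beta>"
proof -
  have "\<exists>!bs. [] \<notin> set bs \<and> concat bs = \<alpha> \<and> map sum_list bs = \<beta>"
    using assms blocks_unique by (fastforce simp: comp_le_def)
  from theI'[OF this] show "[] \<notin> set (comp_blocks \<alpha> \<beta>)" "concat (comp_blocks \<alpha> \<beta>) = \<alpha>"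
    "map sum_list (comp_blocks \<alpha> \<beta>) = \<beta>"
    by (auto simp: comp_blocks_def)
qed

lemma finite_compositions: "finite {\<gamma>. is_composition \<gamma> \<and> sum_list \<gamma> = n}"
proof (rule inj_on_finite)
  show "inj_on comp_subset {\<gamma>. is_composition \<gamma> \<and> sum_list \<gamma> = n}"
    by (auto intro!: inj_onI comp_subset_inject)
  show "comp_subset ` {\<gamma>. is_composition \<gamma> \<and> sum_list \<gamma> = n} \<subseteq> Pow {1..<n}"
    using comp_subset_bounds by blast
qed simp

section \<open>Breaking a composition at its ascents\<close>

lemma break_at_nonempty: "xs \<noteq> [] \<Longrightarrow> break_at R xs \<noteq> []" "[] \<notin> set (break_at R xs)"
  by (induction R xs rule: break_at.induct) (auto dest: list.set_sel(2) split: if_splits)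

lemma concat_break_at: "concat (break_at R xs) = xs"
proof (induction R xs rule: break_at.induct)
  case (3 R x y zs)
  then show ?case
    using break_at_nonempty(1)[of "y # zs" R] by (cases "break_at R (y # zs)") auto
qed auto

text \<open>The set called \<open>C\<close> in the overview.\<close>

definition ascents :: "(nat \<Rightarrow> nat \<Rightarrow> bool) \<Rightarrow> nat list \<Rightarrow> nat set" where
  "ascents prec \<alpha> =
     {sum_list (take i \<alpha>) | i. 1 \<le> i \<and> i < length \<alpha> \<and> prec (\<alpha> ! (i - 1)) (\<alpha> ! i)}"

lemma ascents_image:
  "ascents prec \<alpha> = (\<lambda>i. sum_list (take (Suc i) \<alpha>)) ` {i. Suc i < length \<alpha> \<and> prec (\<alpha> ! i) (\<alpha> ! Suc i)}"
proof -
  have "i \<ge> 1 \<Longrightarrow> \<exists>k. i = Suc k" for i :: nat by presburger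
  then show ?thesis unfolding ascents_def by force
qed

text \<open>The induction follows the recursion of \<open>break_at\<close>. An ascent at the front
  makes \<open>x\<close> a block of its own and a cut; otherwise \<open>x\<close> joins the first
  block. In both cases the later cuts are shifted by \<open>x\<close>.\<close>

lemma comp_subset_C_comp: "comp_subset (C_comp prec \<alpha>) = ascents prec \<alpha>"
proof (induction prec \<alpha> rule: break_at.induct)
  case (3 R x y zs)
  have split: "{i. Suc i < length (x # y # zs) \<and> R ((x # y # zs) ! i) ((x # y # zs) ! Suc i)} =
      (if R x y then {0} else {}) \<union>
      Suc ` {i. Suc i < length (y # zs) \<and> R ((y # zs) ! i) ((y # zs) ! Suc i)}" (is "?L = ?R")
  proof (rule set_eqI)
    fix i show "i \<in> ?L \<longleftrightarrow> i \<in> ?R" by (cases i) auto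
  qed
  have asc: "ascents R (x # y # zs) = (if R x y then {x} else {}) \<union> (+) x ` ascents R (y # zs)"
    unfolding ascents_image split by (auto simp: image_Un image_image)
  obtain b bs where bs: "break_at R (y # zs) = b # bs"
    using break_at_nonempty(1)[of "y # zs" R] by (cases "break_at R (y # zs)") auto
  show ?case
  proof (cases "R x y")
    case True
    with 3 bs show ?thesis unfolding asc by (simp add: C_comp_def comp_subset_Cons)
  next
    case False
    with 3 bs show ?thesis unfolding asc
      by (cases "bs = []") (auto simp: C_comp_def comp_subset_Cons image_image add.assoc)
  qed
qed (auto simp: C_comp_def comp_subset_Cons ascents_def)

lemma comp_le_C_comp: "is_composition \<alpha> \<Longrightarrow> comp_le \<alpha> (C_comp prec \<alpha>)"
  unfolding comp_le_def C_comp_def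
  using break_at_nonempty(2)[of prec \<alpha>] concat_break_at[of prec \<alpha>] by blast

section \<open>Bijections increasing on cells\<close>

text \<open>The cells are the fibres of \<open>c\<close> on \<open>I\<close>. Extensionality makes
  the functions determined by their values on \<open>I\<close>, so that they can be counted.\<close>

definition cellwise_increasing_bijections ::
  "nat set \<Rightarrow> nat set \<Rightarrow> (nat \<Rightarrow> 'b) \<Rightarrow> (nat \<Rightarrow> nat) set" where
  "cellwise_increasing_bijections I Y c = {w \<in> extensional I. bij_betw w I Y \<and>
     (\<forall>p\<in>I. \<forall>q\<in>I. p < q \<and> c p = c q \<longrightarrow> w p < w q)}"

text \<open>Read along \<open>I\<close> in increasing order, both functions list the same set in
  increasing order, and a finite set has only one such list.\<close>

lemma increasing_determined_by_image:
  fixes v w :: "nat \<Rightarrow> nat"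
  assumes "finite I" "v ` I = w ` I" "p \<in> I"
    and "\<And>p q. p \<in> I \<Longrightarrow> q \<in> I \<Longrightarrow> p < q \<Longrightarrow> v p < v q"
    and "\<And>p q. p \<in> I \<Longrightarrow> q \<in> I \<Longrightarrow> p < q \<Longrightarrow> w p < w q"
  shows "v p = w p"
proof -
  have sorted: "sorted_wrt (<) (map u (sorted_list_of_set I))"
    if "\<And>p q. p \<in> I \<Longrightarrow> q \<in> I \<Longrightarrow> p < q \<Longrightarrow> u p < u q" for u :: "nat \<Rightarrow> nat"
    unfolding sorted_wrt_map
    by (rule sorted_wrt_mono_rel[of _ "(<)"]) (use assms(1) that in auto)
  have "map v (sorted_list_of_set I) = map w (sorted_list_of_set I)"
    using sorted[of v, OF assms(4)] sorted[of w, OF assms(5)] assms(1,2)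
    by (intro sorted_distinct_set_unique) (auto simp: strict_sorted_iff)
  then show ?thesis using assms(1,3) by simp
qed

text \<open>Both sets are enumerated increasingly by the same initial segment; the bijection passes
  through this segment.\<close>

lemma increasing_bijection_exists:
  fixes I Z :: "nat set"
  assumes "finite I" "finite Z" "card I = card Z"
  shows "\<exists>h. bij_betw h I Z \<and> (\<forall>p\<in>I. \<forall>q\<in>I. p < q \<longrightarrow> h p < h q)"
proof -
  obtain f where f: "bij_betw f {..<card I} I" "strict_mono_on {..<card I} f"
    using ex_bij_betw_strict_mono_card[OF assms(1)] by metis
  obtain g where g: "bij_betw g {..<card I} Z" "strict_mono_on {..<card I} g"
    using ex_bij_betw_strict_mono_card[OF assms(2)] assms(3) by metis
  let ?f' = "the_inv_into {..<card I} f"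
  have f': "bij_betw ?f' I {..<card I}" using bij_betw_the_inv_into f(1) .
  have "?f' p < ?f' q" if "p \<in> I" "q \<in> I" "p < q" for p q
  proof (rule ccontr)
    assume "\<not> ?f' p < ?f' q"
    moreover have "?f' p \<in> {..<card I}" "?f' q \<in> {..<card I}"
      using f' that bij_betwE by blast+
    ultimately have "f (?f' q) \<le> f (?f' p)"
      using strict_mono_on_leD[OF f(2)] by simp
    then show False using that f_the_inv_into_f_bij_betw[OF f(1)] by force
  qed
  then have "g (?f' p) < g (?f' q)" if "p \<in> I" "q \<in> I" "p < q" for p q
    using that g(2) f' by (meson bij_betwE strict_mono_onD)
  with bij_betw_trans[OF f' g(1)] show ?thesis by auto
qed

text \<open>On the cell \<open>b\<close> an increasing function is determined by its set of values,
  and every set of the right size occurs. Splitting off this set is the recursion that produces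
  multinomial coefficients.\<close>

lemma cellwise_increasing_split:
  fixes c :: "nat \<Rightarrow> 'b" and b :: 'b
  assumes "finite I" "finite Y" "card I = card Y"
  defines "I0 \<equiv> {p \<in> I. c p = b}"
  shows "bij_betw (\<lambda>w. (w ` I0, restrict w (I - I0))) (cellwise_increasing_bijections I Y c)
    (SIGMA Z:{Z. Z \<subseteq> Y \<and> card Z = card I0}. cellwise_increasing_bijections (I - I0) (Y - Z) c)"
    (is "bij_betw ?\<Phi> ?A ?B")
proof (rule bij_betw_imageI)
  have I0: "I0 \<subseteq> I" "finite I0" using assms(1) by (auto simp: I0_def)
  show "inj_on ?\<Phi> ?A"
  proof (rule inj_onI)
    fix v w assume vw: "v \<in> ?A" "w \<in> ?A" "?\<Phi> v = ?\<Phi> w"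
    have "v p = w p" if "p \<in> I" for p
    proof (cases "p \<in> I0")
      case True
      then show ?thesis using vw I0
        by (intro increasing_determined_by_image[of I0])
          (auto simp: cellwise_increasing_bijections_def I0_def)
    next
      case False
      then show ?thesis using vw that by (metis DiffI prod.inject restrict_apply')
    qed
    then show "v = w" using vw by (auto simp: cellwise_increasing_bijections_def intro: extensionalityI)
  qed
  show "?\<Phi> ` ?A = ?B"
  proof
    show "?\<Phi> ` ?A \<subseteq> ?B"
    proof
      fix x assume "x \<in> ?\<Phi> ` ?A"
      then obtain w where w: "w \<in> ?A" "x = ?\<Phi> w" by blast
      then have bij: "bij_betw w I Y" by (simp add: cellwise_increasing_bijections_def)
      have inj: "inj_on w I0" using bij I0 by (meson bij_betw_imp_inj_on inj_on_subset)
      have "w ` (I - I0) = Y - w ` I0"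
        using bij I0(1) by (metis bij_betw_def inj_on_image_set_diff Diff_subset)
      then have "bij_betw (restrict w (I - I0)) (I - I0) (Y - w ` I0)"
        using bij by (metis bij_betw_restrict_eq bij_betw_subset Diff_subset)
      moreover have "w ` I0 \<subseteq> Y" using bij I0(1) by (auto simp: bij_betw_def)
      ultimately show "x \<in> ?B"
        using w inj by (auto simp: cellwise_increasing_bijections_def card_image)
    qed
    show "?B \<subseteq> ?\<Phi> ` ?A"
    proof
      fix x assume "x \<in> ?B"
      then obtain Z v where Z: "x = (Z, v)" "Z \<subseteq> Y" "card Z = card I0"
        and v: "v \<in> cellwise_increasing_bijections (I - I0) (Y - Z) c" by auto
      have "finite Z" using Z assms(2) finite_subset by blast
      then obtain h where h: "bij_betw h I0 Z" "\<And>p q. p \<in> I0 \<Longrightarrow> q \<in> I0 \<Longrightarrow> p < q \<Longrightarrow> h p < h q"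
        using increasing_bijection_exists[of I0 Z] I0 Z by auto
      define w where "w = (\<lambda>p. if p \<in> I0 then h p else v p)"
      have "bij_betw w I0 Z" using h(1) by (subst bij_betw_cong[of I0 w h]) (auto simp: w_def)
      moreover have "bij_betw w (I - I0) (Y - Z)"
        using v by (subst bij_betw_cong[of "I - I0" w v])
          (auto simp: w_def cellwise_increasing_bijections_def)
      ultimately have "bij_betw w (I0 \<union> (I - I0)) (Z \<union> (Y - Z))"
        by (intro bij_betw_combine) auto
      then have "bij_betw w I Y" using I0 Z by (simp add: Un_absorb1 Un_Diff_cancel)
      moreover have "w \<in> extensional I"
        using v I0 by (auto simp: w_def extensional_def cellwise_increasing_bijections_def)
      moreover have "w p < w q" if "p \<in> I" "q \<in> I" "p < q" "c p = c q" for p q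
        using that v h(2) by (auto simp: w_def I0_def cellwise_increasing_bijections_def)
      ultimately have "w \<in> ?A" by (auto simp: cellwise_increasing_bijections_def)
      moreover have "restrict w (I - I0) = v"
        using v by (intro extensionalityI[of _ "I - I0"])
          (auto simp: w_def cellwise_increasing_bijections_def)
      moreover have "w ` I0 = Z" using \<open>bij_betw w I0 Z\<close> by (simp add: bij_betw_def)
      ultimately show "x \<in> ?\<Phi> ` ?A" using Z(1) by force
    qed
  qed
qed

lemma finite_cellwise_increasing_bijections:
  assumes "finite I" "finite Y"
  shows "finite (cellwise_increasing_bijections I Y c)"
proof (rule finite_subset)
  show "cellwise_increasing_bijections I Y c \<subseteq> I \<rightarrow>\<^sub>E Y"
    by (auto simp: cellwise_increasing_bijections_def PiE_def bij_betw_def)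
qed (simp add: finite_PiE assms)

text \<open>The multinomial coefficient, written as a product to avoid division of natural numbers.
  Each cell split off in the induction contributes a binomial coefficient for the choice of its
  values.\<close>

lemma card_cellwise_increasing_bijections:
  fixes c :: "nat \<Rightarrow> 'b" and b :: 'b
  assumes "finite K" "finite I" "finite Y" "card I = card Y" "c ` I \<subseteq> K"
  shows "card (cellwise_increasing_bijections I Y c) * (\<Prod>b\<in>K. fact (card {p \<in> I. c p = b})) =
    (fact (card I) :: nat)"
  using assms
proof (induction K arbitrary: I Y rule: finite_induct)
  case empty
  then have "I = {}" "Y = {}" by auto
  then have "cellwise_increasing_bijections I Y c = {\<lambda>_. undefined}"
    by (auto simp: cellwise_increasing_bijections_def bij_betw_def)
  then show ?case using \<open>I = {}\<close> by simp
next
  case (insert b K)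
  define I0 where "I0 = {p \<in> I. c p = b}"
  have I0: "I0 \<subseteq> I" "finite I0" using insert.prems by (auto simp: I0_def)
  let ?\<Z> = "{Z. Z \<subseteq> Y \<and> card Z = card I0}"
  let ?P = "\<Prod>b\<in>K. fact (card {p \<in> I - I0. c p = b}) :: nat"
  have P: "(\<Prod>b\<in>K. fact (card {p \<in> I. c p = b})) = ?P"
    using insert.hyps by (intro prod.cong refl arg_cong[where f = "\<lambda>X. fact (card X)"]) (auto simp: I0_def)
  have rest: "card (cellwise_increasing_bijections (I - I0) (Y - Z) c) * ?P = fact (card I - card I0)"
    if "Z \<in> ?\<Z>" for Z
  proof -
    have "finite Z" using that insert.prems finite_subset by blast
    then have "card (I - I0) = card (Y - Z)"
      using that insert.prems I0 by (simp add: card_Diff_subset)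
    moreover have "c ` (I - I0) \<subseteq> K" using insert.prems by (auto simp: I0_def)
    ultimately show ?thesis
      using insert.IH[of "I - I0" "Y - Z"] insert.prems I0 by (simp add: card_Diff_subset)
  qed
  have "card (cellwise_increasing_bijections I Y c) =
      (\<Sum>Z\<in>?\<Z>. card (cellwise_increasing_bijections (I - I0) (Y - Z) c))"
    using bij_betw_same_card[OF cellwise_increasing_split[OF insert.prems(1-3), where c = c and b = b]]
      insert.prems by (simp add: I0_def finite_cellwise_increasing_bijections)
  then have "card (cellwise_increasing_bijections I Y c) * ?P =
      card ?\<Z> * fact (card I - card I0)"
    using rest by (simp add: sum_distrib_right)
  moreover have "card ?\<Z> = card I choose card I0"
    using insert.prems n_subsets[of Y "card I0"] by simp
  moreover have "(\<Prod>b\<in>insert b K. fact (card {p \<in> I. c p = b})) = fact (card I0) * ?P"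
    using insert.hyps P by (simp add: I0_def)
  moreover have "fact (card I0) * fact (card I - card I0) * (card I choose card I0) = (fact (card I) :: nat)"
    using I0 insert.prems by (intro binomial_fact_lemma card_mono)
  ultimately show ?case
    by (metis (no_types, lifting) mult.assoc mult.commute)
qed

section \<open>Fillings increasing on blocks\<close>

text \<open>This will be the cell function \<open>c\<close> of the previous section. Beyond the end
  of the concatenation the value is the number of blocks.\<close>

fun block_index :: "'a list list \<Rightarrow> nat \<Rightarrow> nat" where
  "block_index [] p = 0"
| "block_index (b # bs) p = (if p < length b then 0 else Suc (block_index bs (p - length b)))"

text \<open>The ribbon for the part size \<open>x\<close> receives one box for each of these
  positions, so its fillings can be encoded as functions on them.\<close>

definition positions :: "'a list \<Rightarrow> 'a \<Rightarrow> nat set" where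
  "positions xs x = {p. p < length xs \<and> xs ! p = x}"

lemma finite_positions [simp]: "finite (positions xs x)"
  by (simp add: positions_def)

lemma card_positions: "card (positions xs x) = count_list xs x"
  by (simp add: positions_def count_list_eq_length_filter length_filter_conv_card)
    (metis (no_types, lifting))

lemma block_index_less: "p < length (concat bs) \<Longrightarrow> block_index bs p < length bs"
  by (induction bs p rule: block_index.induct) auto

lemma block_index_mono: "p \<le> q \<Longrightarrow> q < length (concat bs) \<Longrightarrow> block_index bs p \<le> block_index bs q"
  by (induction bs arbitrary: p q) auto

lemma card_block_positions:
  "i < length bs \<Longrightarrow> card {p \<in> positions (concat bs) x. block_index bs p = i} = count_list (bs ! i) x"
proof (induction bs arbitrary: i)
  case (Cons b bs)
  show ?case
  proof (cases i)
    case 0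
    have "{p \<in> positions (concat (b # bs)) x. block_index (b # bs) p = 0} = positions b x"
      by (auto simp: positions_def nth_append split: if_splits)
    with 0 show ?thesis by (simp add: card_positions)
  next
    case (Suc k)
    have "{p \<in> positions (concat (b # bs)) x. block_index (b # bs) p = Suc k} =
        (+) (length b) ` {p \<in> positions (concat bs) x. block_index bs p = k}" (is "?L = ?R")
    proof
      show "?L \<subseteq> ?R"
      proof
        fix p assume "p \<in> ?L"
        then have "length b \<le> p" "p - length b \<in> {p \<in> positions (concat bs) x. block_index bs p = k}"
          by (auto simp: positions_def nth_append split: if_splits)
        then show "p \<in> ?R" by (intro image_eqI[of _ _ "p - length b"]) auto
      qed
    qed (auto simp: positions_def nth_append)
    then have "card ?L = card {p \<in> positions (concat bs) x. block_index bs p = k}"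
      by (simp add: card_image)
    with Suc Cons show ?thesis by simp
  qed
qed simp

text \<open>Matches the product over the cells with a denominator of
  \<open>comp_coeff\<close>.\<close>

lemma prod_card_block_positions:
  "(\<Prod>i<length bs. fact (card {p \<in> positions (concat bs) x. block_index bs p = i})) =
   (\<Prod>b\<leftarrow>bs. fact (count_list b x) :: nat)"
  by (simp add: card_block_positions prod.list_conv_set_nth atLeast0LessThan)

text \<open>A block ends after position \<open>p\<close> exactly when the partial sum through
  \<open>p\<close> is a cut; as the parts are positive, no other prefix has the same sum.\<close>

lemma block_index_Suc_eq_iff:
  assumes "is_composition (concat bs)" "Suc p < length (concat bs)" "[] \<notin> set bs"
  shows "block_index bs (Suc p) = block_index bs p \<longleftrightarrow>
    sum_list (take (Suc p) (concat bs)) \<notin> comp_subset (map sum_list bs)"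
  using assms
proof (induction bs arbitrary: p)
  case (Cons b bs)
  have comp: "is_composition b" "is_composition (concat bs)" using Cons.prems by simp_all
  have bs: "comp_subset (map sum_list (b # bs)) =
      (if bs = [] then {} else insert (sum_list b) ((+) (sum_list b) ` comp_subset (map sum_list bs)))"
    by (simp add: comp_subset_Cons)
  have "0 < sum_list x" if "x \<in> set bs" for x
    using that Cons.prems comp by (intro sum_list_pos_composition) (auto simp: is_composition_def)
  then have "is_composition (map sum_list bs)"
    unfolding is_composition_def set_map by (metis imageE less_irrefl)
  then have no0: "0 \<notin> comp_subset (map sum_list bs)" using comp_subset_bounds by fastforce
  consider "Suc p < length b" | "Suc p = length b" | "length b \<le> p" by linarith
  then show ?case
  proof cases
    case 1
    then have "sum_list (take (Suc p) b) < sum_list b"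
      using partial_sum_less[OF comp(1), of "Suc p" "length b"] by simp
    with 1 show ?thesis unfolding bs by auto
  next
    case 2
    then have "bs \<noteq> []" using Cons.prems(2) by auto
    with 2 show ?thesis unfolding bs by simp
  next
    case 3
    have "concat bs \<noteq> []"
    proof
      assume e: "concat bs = []"
      show False using 3 Cons.prems(2) unfolding concat.simps e by simp
    qed
    define S where "S = sum_list (take (Suc (p - length b)) (concat bs))"
    \<comment> \<open>Hence the partial sum lies strictly beyond the cut \<open>sum_list b\<close>
      and can only come from a cut of the remaining blocks.\<close>
    have "0 < S" unfolding S_def
      using comp \<open>concat bs \<noteq> []\<close>
      by (intro sum_list_pos_composition is_composition_sublists) simp_all
    have Suc: "Suc p - length b = Suc (p - length b)" using 3 by simp
    have "sum_list (take (Suc p) (concat (b # bs))) = sum_list b + S"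
      using 3 by (simp add: S_def Suc)
    moreover have "bs \<noteq> []" using \<open>concat bs \<noteq> []\<close> by auto
    ultimately have "sum_list (take (Suc p) (concat (b # bs))) \<notin> comp_subset (map sum_list (b # bs)) \<longleftrightarrow>
        S \<notin> comp_subset (map sum_list bs)"
      using \<open>0 < S\<close> unfolding bs by (simp add: image_iff del: concat.simps sum_list_eq_0_iff)
    also have "\<dots> \<longleftrightarrow> block_index bs (Suc (p - length b)) = block_index bs (p - length b)"
      using Cons.IH[of "p - length b"] Cons.prems comp 3 by (simp add: S_def)
    finally show ?thesis using 3 by (simp add: Suc)
  qed
qed simp

text \<open>Descents between adjacent equal parts are allowed at the elements of \<open>G\<close>
  but not forced there. Occurrences of \<open>j\<close> that are separated by other parts are not
  compared.\<close>

definition cut_fillings :: "nat list \<Rightarrow> nat set \<Rightarrow> nat \<Rightarrow> (nat \<Rightarrow> nat) set" where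
  "cut_fillings \<alpha> G j = {w \<in> extensional (positions \<alpha> j).
     bij_betw w (positions \<alpha> j) {1..count_list \<alpha> j} \<and>
     (\<forall>p. p \<in> positions \<alpha> j \<and> Suc p \<in> positions \<alpha> j \<and> sum_list (take (Suc p) \<alpha>) \<notin> G \<longrightarrow>
        w p < w (Suc p))}"

text \<open>Without an ascent the parts decrease weakly from \<open>p\<close> to \<open>q\<close>,
  so equal parts at the ends squeeze everything between them.\<close>

lemma parts_between_equal_parts:
  fixes prec :: "nat \<Rightarrow> nat \<Rightarrow> bool"
  assumes "irreflp_on {0<..} prec" "transp_on {0<..} prec" "totalp_on {0<..} prec"
    and "is_composition \<alpha>" and q: "q < length \<alpha>" and "p \<le> r" "r \<le> q" and "\<alpha> ! p = \<alpha> ! q"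
    and no_asc: "\<And>i. p \<le> i \<Longrightarrow> i < q \<Longrightarrow> \<not> prec (\<alpha> ! i) (\<alpha> ! Suc i)"
  shows "\<alpha> ! r = \<alpha> ! p"
proof -
  have pos: "\<alpha> ! i \<in> {0<..}" if "i \<le> q" for i
    using assms(4) q that by (auto simp: is_composition_def intro!: gr0I) (metis le_less_trans nth_mem)
  \<comment> \<open>Non-ascents compose: by totality a non-ascent between different parts is a
    strict relation in the other direction, and transitivity applies to it.\<close>
  have desc: "\<not> prec (\<alpha> ! i) (\<alpha> ! j)" if "i \<le> j" "p \<le> i" "j \<le> q" for i j
    using that
  proof (induction j rule: dec_induct)
    case base
    then show ?case using assms(1) pos by (auto dest: irreflp_onD)
  next
    case (step j)
    show ?case
    proof
      assume a: "prec (\<alpha> ! i) (\<alpha> ! Suc j)"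
      have *: "\<not> prec (\<alpha> ! i) (\<alpha> ! j)" "\<not> prec (\<alpha> ! j) (\<alpha> ! Suc j)" using step no_asc by auto
      have P: "\<alpha> ! i \<in> {0<..}" "\<alpha> ! j \<in> {0<..}" "\<alpha> ! Suc j \<in> {0<..}" using pos step by auto
      have "\<alpha> ! i \<noteq> \<alpha> ! j" using a * by metis
      then have "prec (\<alpha> ! j) (\<alpha> ! i)" using totalp_onD[OF assms(3) P(1,2)] * by blast
      then show False using transp_onD[OF assms(2) P(2,1,3)] a * by blast
    qed
  qed
  show ?thesis
  proof (rule ccontr)
    assume "\<alpha> ! r \<noteq> \<alpha> ! p"
    then have "prec (\<alpha> ! r) (\<alpha> ! p)"
      using totalp_onD[OF assms(3) pos pos, of r p] desc[of p r] assms(6,7) by auto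
    then show False using desc[of r q] assms by simp
  qed
qed

lemma increasing_chain:
  assumes "(p::nat) < q" "\<And>r. p \<le> r \<Longrightarrow> r < q \<Longrightarrow> (f r :: 'a::order) < f (Suc r)"
  shows "f p < f q"
  using assms
proof (induction q)
  case (Suc q)
  then show ?case by (cases "p = q") (auto intro: less_trans)
qed simp

text \<open>\<gamma> has a cut at every ascent of \<alpha>, so its blocks contain no ascent and
  equal parts within one block occupy consecutive positions. The conditions on adjacent positions
  therefore chain up to monotonicity on each block.\<close>

lemma cut_fillings_eq:
  assumes ord: "irreflp_on {0<..} prec" "transp_on {0<..} prec" "totalp_on {0<..} prec"
    and \<gamma>: "comp_le \<alpha> \<gamma>" "comp_le \<gamma> (C_comp prec \<alpha>)"
  shows "cut_fillings \<alpha> (comp_subset \<gamma>) j =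
    cellwise_increasing_bijections (positions \<alpha> j) {1..count_list \<alpha> j} (block_index (comp_blocks \<alpha> \<gamma>))"
proof -
  let ?bs = "comp_blocks \<alpha> \<gamma>" and ?I = "positions \<alpha> j"
  note bs = comp_blocks[OF \<gamma>(1)]
  have comp: "is_composition \<alpha>" using \<gamma>(1) by (simp add: comp_le_iff)
  have idx: "block_index ?bs (Suc p) = block_index ?bs p \<longleftrightarrow> sum_list (take (Suc p) \<alpha>) \<notin> comp_subset \<gamma>"
    if "Suc p < length \<alpha>" for p
    using block_index_Suc_eq_iff[of ?bs p] that bs comp by simp
  have asc: "ascents prec \<alpha> \<subseteq> comp_subset \<gamma>"
    using \<gamma>(2) by (simp add: comp_le_iff comp_subset_C_comp)
  have between: "r \<in> ?I \<and> block_index ?bs r = block_index ?bs p"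
    if pq: "p \<in> ?I" "q \<in> ?I" "block_index ?bs p = block_index ?bs q" and r: "p \<le> r" "r \<le> q" for p q r
  proof -
    have q: "q < length \<alpha>" using pq by (simp add: positions_def)
    have same: "block_index ?bs i = block_index ?bs p" if "p \<le> i" "i \<le> q" for i
      using block_index_mono[of p i ?bs] block_index_mono[of i q ?bs] that q pq(3) bs by simp
    have "\<not> prec (\<alpha> ! i) (\<alpha> ! Suc i)" if i: "p \<le> i" "i < q" for i
    proof
      assume "prec (\<alpha> ! i) (\<alpha> ! Suc i)"
      then have "sum_list (take (Suc i) \<alpha>) \<in> comp_subset \<gamma>"
        using asc i q by (auto simp: ascents_image)
      then show False using idx[of i] same[of i] same[of "Suc i"] i q by auto
    qed
    then have "\<alpha> ! r = \<alpha> ! p"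
      using pq by (intro parts_between_equal_parts[OF ord comp q r]) (auto simp: positions_def)
    then show ?thesis using same[OF r] pq q r by (simp add: positions_def)
  qed
  have iff: "(\<forall>p. p \<in> ?I \<and> Suc p \<in> ?I \<and> sum_list (take (Suc p) \<alpha>) \<notin> comp_subset \<gamma> \<longrightarrow> w p < w (Suc p)) \<longleftrightarrow>
      (\<forall>p\<in>?I. \<forall>q\<in>?I. p < q \<and> block_index ?bs p = block_index ?bs q \<longrightarrow> w p < w q)"
    (is "?A \<longleftrightarrow> ?B") for w :: "nat \<Rightarrow> nat"
  proof
    assume A: ?A
    show ?B
    proof (intro ballI impI)
      fix p q assume pq: "p \<in> ?I" "q \<in> ?I" "p < q \<and> block_index ?bs p = block_index ?bs q"
      show "w p < w q"
      proof (rule increasing_chain[where f = w])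
        fix r assume r: "p \<le> r" "r < q"
        have "r \<in> ?I" "Suc r \<in> ?I" "block_index ?bs (Suc r) = block_index ?bs r"
          using between[of p q r] between[of p q "Suc r"] pq r by auto
        then show "w r < w (Suc r)" using A idx[of r] by (auto simp: positions_def)
      qed (use pq in simp)
    qed
  next
    assume B: ?B
    show ?A
    proof (intro allI impI)
      fix p assume p: "p \<in> ?I \<and> Suc p \<in> ?I \<and> sum_list (take (Suc p) \<alpha>) \<notin> comp_subset \<gamma>"
      then have "block_index ?bs p = block_index ?bs (Suc p)"
        using idx[of p] by (simp add: positions_def)
      with B p show "w p < w (Suc p)" by blast
    qed
  qed
  show ?thesis unfolding cut_fillings_def cellwise_increasing_bijections_def iff ..
qed

text \<open>With the blocks of \<gamma> as cells, this is the multinomial coefficient that the part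
  size \<open>j\<close> contributes to \<open>comp_coeff\<close>.\<close>

lemma card_cut_fillings:
  assumes "irreflp_on {0<..} prec" "transp_on {0<..} prec" "totalp_on {0<..} prec"
    and \<gamma>: "comp_le \<alpha> \<gamma>" "comp_le \<gamma> (C_comp prec \<alpha>)"
  shows "card (cut_fillings \<alpha> (comp_subset \<gamma>) j) * (\<Prod>b\<leftarrow>comp_blocks \<alpha> \<gamma>. fact (count_list b j)) =
    fact (count_list \<alpha> j)"
proof -
  let ?bs = "comp_blocks \<alpha> \<gamma>"
  have bs: "concat ?bs = \<alpha>" using comp_blocks[OF \<gamma>(1)] by simp
  have "block_index ?bs ` positions \<alpha> j \<subseteq> {..<length ?bs}"
    using block_index_less[of _ ?bs] bs by (auto simp: positions_def)
  then have "card (cut_fillings \<alpha> (comp_subset \<gamma>) j) *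
      (\<Prod>i<length ?bs. fact (card {p \<in> positions \<alpha> j. block_index ?bs p = i})) = fact (count_list \<alpha> j)"
    unfolding cut_fillings_eq[OF assms]
    by (subst card_cellwise_increasing_bijections) (auto simp: card_positions)
  then show ?thesis using prod_card_block_positions[of ?bs j] bs by simp
qed

section \<open>Running the ribbon procedure\<close>

lemma length_ribbon_at [simp]: "length (ribbon_at r c \<beta>) = sum_list \<beta>"
  by (induction r c \<beta> rule: ribbon_at.induct) auto

text \<open>Boxes are counted from 0, so box number \<open>g\<close> is the first of a new row
  exactly when \<open>g\<close> is a cut; hence the weak inequality.\<close>

lemma row_ribbon_at:
  assumes "is_composition \<beta>" "q < sum_list \<beta>"
  shows "fst (ribbon_at r c \<beta> ! q) = r + card {g \<in> comp_subset \<beta>. g \<le> q}"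
  using assms
proof (induction \<beta> arbitrary: r c q)
  case (Cons b bs)
  show ?case
  proof (cases "q < b")
    case True
    then have "{g \<in> comp_subset (b # bs). g \<le> q} = {}" by (auto simp: comp_subset_Cons)
    with True show ?thesis by (simp add: nth_append)
  next
    case False
    then have "bs \<noteq> []" using Cons.prems by auto
    then have "{g \<in> comp_subset (b # bs). g \<le> q} =
        insert b ((+) b ` {g \<in> comp_subset bs. g \<le> q - b})"
      using False by (auto simp: comp_subset_Cons)
    moreover have "b \<notin> (+) b ` {g \<in> comp_subset bs. g \<le> q - b}"
      using comp_subset_bounds[of bs] Cons.prems by auto
    ultimately have "card {g \<in> comp_subset (b # bs). g \<le> q} = Suc (card {g \<in> comp_subset bs. g \<le> q - b})"
      by (simp add: card_image)
    moreover have "fst (ribbon_at (r + 1) (c + b - 1) bs ! (q - b)) =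
        r + 1 + card {g \<in> comp_subset bs. g \<le> q - b}"
      using Cons.prems False by (intro Cons.IH) auto
    ultimately show ?thesis using False by (simp add: nth_append)
  qed
qed simp

text \<open>The counting function is weakly increasing and rises by exactly one at each element of
  \<open>B\<close>. An element at the left end \<open>s\<close> affects only the starting value, not
  the number of values.\<close>

lemma card_image_counting_function:
  fixes B :: "nat set"
  assumes "finite B" "0 < a"
  shows "card ((\<lambda>q. card {g \<in> B. g \<le> q}) ` {s..<s + a}) = Suc (card {g \<in> B. s < g \<and> g < s + a})"
proof -
  let ?f = "\<lambda>q. card {g \<in> B. g \<le> q}"
  have mono: "?f p \<le> ?f q" if "p \<le> q" for p q
    using that assms(1) by (intro card_mono) auto
  have "Suc 0 \<le> a" using assms(2) by simp
  then show ?thesis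
  proof (induction a rule: dec_induct)
    case base
    have "{g \<in> B. s < g \<and> g < s + Suc 0} = {}" by auto
    then show ?case by simp
  next
    case (step a)
    have img: "?f ` {s..<s + Suc a} = insert (?f (s + a)) (?f ` {s..<s + a})"
      by (simp add: atLeastLessThanSuc)
    obtain a' where a': "a = Suc a'" using step.hyps by (cases a) auto
    show ?case
    proof (cases "s + a \<in> B")
      case True
      have "{g \<in> B. g \<le> s + a} = insert (s + a) {g \<in> B. g \<le> s + a'}"
        using True a' by auto
      then have "?f (s + a) = Suc (?f (s + a'))" using assms(1) a' by simp
      moreover have "?f q \<le> ?f (s + a')" if "q \<in> {s..<s + a}" for q
        using that a' by (intro mono) auto
      ultimately have "?f (s + a) \<notin> ?f ` {s..<s + a}" by fastforce
      moreover have "{g \<in> B. s < g \<and> g < s + Suc a} = insert (s + a) {g \<in> B. s < g \<and> g < s + a}"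
        using True step.hyps by auto
      ultimately show ?thesis using step.IH assms(1) unfolding img by simp
    next
      case False
      then have "{g \<in> B. g \<le> s + a} = {g \<in> B. g \<le> s + a'}"
        using a' by (auto simp: le_Suc_eq)
      then have "?f (s + a) \<in> ?f ` {s..<s + a}" using a' by (intro image_eqI[of _ _ "s + a'"]) auto
      moreover have "{g \<in> B. s < g \<and> g < s + Suc a} = {g \<in> B. s < g \<and> g < s + a}"
        using False by (auto simp: less_Suc_eq)
      ultimately show ?thesis using step.IH unfolding img by (simp add: insert_absorb)
    qed
  qed
qed

text \<open>Consequently \<open>h - 1\<close> in the procedure counts the cuts of \<beta> strictly
  inside the current part of \<alpha>.\<close>

lemma rows_of_ribbon_segment:
  assumes "is_composition \<beta>" "0 < a" "s + a \<le> sum_list \<beta>"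
  shows "card (fst ` set (take a (drop s (ribbon \<beta>)))) =
    Suc (card {g \<in> comp_subset \<beta>. s < g \<and> g < s + a})"
proof -
  have "take a (drop s (ribbon \<beta>)) = map ((!) (ribbon \<beta>)) [s..<s + a]"
    using assms(3) by (intro nth_equalityI) (auto simp: ribbon_def)
  then have "fst ` set (take a (drop s (ribbon \<beta>))) = (\<lambda>q. fst (ribbon \<beta> ! q)) ` {s..<s + a}"
    by (simp add: image_image)
  also have "\<dots> = (\<lambda>q. card {g \<in> comp_subset \<beta>. g \<le> q}) ` {s..<s + a}"
    using assms by (intro image_cong) (auto simp: ribbon_def row_ribbon_at)
  finally show ?thesis using assms(2) by (simp add: card_image_counting_function)
qed

lemma drop_ribbon_at:
  "\<exists>r' c'. drop (sum_list (take j \<beta>)) (ribbon_at r c \<beta>) = ribbon_at r' c' (drop j \<beta>)"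
proof (induction \<beta> arbitrary: r c j)
  case (Cons b bs)
  then show ?case by (cases j) auto
qed auto

text \<open>For the direction from left to right it suffices to compare lengths: they force
  \<open>s\<close> to be the partial sum at \<open>j\<close>, and \<open>0 < s\<close> excludes
  \<open>j = 0\<close>.\<close>

lemma drop_ribbon_is_ribbon_iff:
  assumes "is_composition \<beta>" "0 < s" "s < sum_list \<beta>"
  shows "(\<exists>j<length \<beta>. \<exists>r c. drop s (ribbon \<beta>) = ribbon_at r c (drop j \<beta>)) \<longleftrightarrow> s \<in> comp_subset \<beta>"
proof
  assume "\<exists>j<length \<beta>. \<exists>r c. drop s (ribbon \<beta>) = ribbon_at r c (drop j \<beta>)"
  then obtain j r c where j: "j < length \<beta>" "drop s (ribbon \<beta>) = ribbon_at r c (drop j \<beta>)" by blast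
  from arg_cong[OF j(2), of length] have "sum_list \<beta> - s = sum_list (drop j \<beta>)"
    by (simp add: ribbon_def)
  moreover have "sum_list \<beta> = sum_list (take j \<beta>) + sum_list (drop j \<beta>)"
    by (metis append_take_drop_id sum_list_append)
  ultimately have "s = sum_list (take j \<beta>)" using assms(3) by linarith
  moreover from this have "j \<noteq> 0" using assms(2) by (metis less_irrefl sum_list.Nil take_0)
  ultimately show "s \<in> comp_subset \<beta>" using j(1) unfolding comp_subset_image by simp
next
  assume "s \<in> comp_subset \<beta>"
  then obtain j where j: "j < length \<beta>" "s = sum_list (take j \<beta>)" by (auto simp: comp_subset_def)
  then show "\<exists>j<length \<beta>. \<exists>r c. drop s (ribbon \<beta>) = ribbon_at r c (drop j \<beta>)"
    using drop_ribbon_at[of j \<beta> 0 0] by (auto simp: ribbon_def)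
qed

text \<open>The displacement, as (rows, columns), by which the procedure adds the box of step
  \<open>p\<close>. Membership of the partial sum in \<open>B\<close> replaces the test on the
  remaining ribbon.\<close>

definition box_step :: "nat list \<Rightarrow> nat set \<Rightarrow> nat \<Rightarrow> nat \<times> nat" where
  "box_step \<alpha> B p = (if p = 0 \<or> \<alpha> ! (p - 1) \<noteq> \<alpha> ! p then (1, 1)
     else if sum_list (take p \<alpha>) \<in> B then (1, 0) else (0, 1))"

text \<open>With \<open>d\<close> a component of \<open>box_step\<close>, this is one more than the
  corresponding coordinate of the box added in step \<open>p\<close>.\<close>

definition box_sum :: "nat list \<Rightarrow> (nat \<Rightarrow> nat) \<Rightarrow> nat \<Rightarrow> nat" where
  "box_sum \<alpha> d p = (\<Sum>q | q \<in> positions \<alpha> (\<alpha> ! p) \<and> q \<le> p. d q)"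

text \<open>The box added in step \<open>p\<close>. The first box of each ribbon counts as a southeast step, which the
  subtraction cancels.\<close>

definition box_at :: "nat list \<Rightarrow> nat set \<Rightarrow> nat \<Rightarrow> box" where
  "box_at \<alpha> B p = (box_sum \<alpha> (fst \<circ> box_step \<alpha> B) p - 1, box_sum \<alpha> (snd \<circ> box_step \<alpha> B) p - 1)"

section \<open>Coordinates of the boxes along one ribbon\<close>

lemma box_sum_eq:
  assumes "p < q" "q < length \<alpha>" "\<alpha> ! p = \<alpha> ! q"
  shows "box_sum \<alpha> d q = box_sum \<alpha> d p + (\<Sum>r | r \<in> positions \<alpha> (\<alpha> ! q) \<and> p < r \<and> r \<le> q. d r)"
proof -
  have "{r. r \<in> positions \<alpha> (\<alpha> ! q) \<and> r \<le> q} =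
      {r. r \<in> positions \<alpha> (\<alpha> ! q) \<and> r \<le> p} \<union> {r. r \<in> positions \<alpha> (\<alpha> ! q) \<and> p < r \<and> r \<le> q}"
    using assms by auto
  then show ?thesis
    unfolding box_sum_def assms(3) by (simp add: sum.union_disjoint disjoint_iff)
qed

lemma box_sum_consecutive:
  assumes "p < q" "q < length \<alpha>" "\<alpha> ! p = \<alpha> ! q" "\<And>r. p < r \<Longrightarrow> r < q \<Longrightarrow> \<alpha> ! r \<noteq> \<alpha> ! q"
  shows "box_sum \<alpha> d q = box_sum \<alpha> d p + d q"
proof -
  have "{r. r \<in> positions \<alpha> (\<alpha> ! q) \<and> p < r \<and> r \<le> q} = {q}"
    using assms by (auto simp: positions_def) (metis le_neq_implies_less)
  then show ?thesis using box_sum_eq[OF assms(1-3), of d] by simp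
qed

lemma box_sum_first:
  assumes "p < length \<alpha>" "\<And>r. r < p \<Longrightarrow> \<alpha> ! r \<noteq> \<alpha> ! p"
  shows "box_sum \<alpha> d p = d p"
proof -
  have "{r. r \<in> positions \<alpha> (\<alpha> ! p) \<and> r \<le> p} = {p}"
    using assms by (auto simp: positions_def) (metis le_neq_implies_less)
  then show ?thesis by (simp add: box_sum_def)
qed

lemma box_step_first:
  "(\<And>r. r < p \<Longrightarrow> \<alpha> ! r \<noteq> \<alpha> ! p) \<Longrightarrow> box_step \<alpha> B p = (1, 1)"
  by (cases p) (auto simp: box_step_def)

text \<open>The first occurrence of the part contributes the step \<open>(1, 1)\<close>, so the
  subtraction in \<open>box_at\<close> is never truncated.\<close>

lemma box_sum_pos:
  assumes "p < length \<alpha>"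
  shows "1 \<le> box_sum \<alpha> (fst \<circ> box_step \<alpha> B) p" "1 \<le> box_sum \<alpha> (snd \<circ> box_step \<alpha> B) p"
proof -
  define m where "m = (LEAST r. \<alpha> ! r = \<alpha> ! p)"
  have m: "\<alpha> ! m = \<alpha> ! p" "m \<le> p" by (auto simp: m_def intro: LeastI Least_le)
  have "\<alpha> ! r \<noteq> \<alpha> ! m" if "r < m" for r
    using not_less_Least[of r "\<lambda>r. \<alpha> ! r = \<alpha> ! p"] that m by (auto simp: m_def)
  then have "box_step \<alpha> B m = (1, 1)" by (rule box_step_first)
  moreover have "m \<in> {r. r \<in> positions \<alpha> (\<alpha> ! p) \<and> r \<le> p}"
    using m assms by (simp add: positions_def)
  then have "d m \<le> box_sum \<alpha> d p" for d
    unfolding box_sum_def by (rule member_le_sum) auto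
  from this[of "fst \<circ> box_step \<alpha> B"] this[of "snd \<circ> box_step \<alpha> B"]
  show "1 \<le> box_sum \<alpha> (fst \<circ> box_step \<alpha> B) p" "1 \<le> box_sum \<alpha> (snd \<circ> box_step \<alpha> B) p"
    using calculation by auto
qed

lemma last_filter_upt:
  "filter P [0..<i] \<noteq> [] \<Longrightarrow>
   P (last (filter P [0..<i])) \<and> last (filter P [0..<i]) < i \<and>
   (\<forall>r<i. P r \<longrightarrow> r \<le> last (filter P [0..<i]))"
proof (induction i)
  case (Suc i)
  then show ?case
    by (cases "P i") (auto simp: less_Suc_eq)
qed simp

text \<open>The last box of the ribbon belongs to the previous occurrence of the same part, and the
  sums for consecutive occurrences differ by one \<open>box_step\<close>. At a first occurrence the
  subtraction in \<open>box_at\<close> turns \<open>(1, 1)\<close> into the initial box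
  \<open>(0, 0)\<close>.\<close>

lemma extend_box_at:
  assumes "i < length \<alpha>" "(dr, dc) = box_step \<alpha> B i"
  shows "extend dr dc (map (box_at \<alpha> B) (filter (\<lambda>p. \<alpha> ! p = \<alpha> ! i) [0..<i])) =
    map (box_at \<alpha> B) (filter (\<lambda>p. \<alpha> ! p = \<alpha> ! i) [0..<Suc i])"
proof (cases "filter (\<lambda>p. \<alpha> ! p = \<alpha> ! i) [0..<i] = []")
  case True
  then have first: "\<alpha> ! r \<noteq> \<alpha> ! i" if "r < i" for r
    using that by (auto simp: filter_empty_conv)
  then have "box_at \<alpha> B i = (0, 0)"
    using assms(1) by (simp add: box_at_def box_sum_first box_step_first)
  with True show ?thesis by (simp add: extend_def)
next
  case False
  define q where "q = last (filter (\<lambda>p. \<alpha> ! p = \<alpha> ! i) [0..<i])"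
  have q: "\<alpha> ! q = \<alpha> ! i" "q < i" "\<And>r. r < i \<Longrightarrow> \<alpha> ! r = \<alpha> ! i \<Longrightarrow> r \<le> q"
    using last_filter_upt[OF False] by (auto simp: q_def)
  have "box_sum \<alpha> d i = box_sum \<alpha> d q + d i" for d
    using q assms(1) by (intro box_sum_consecutive) (auto simp: not_le[symmetric])
  then have "box_at \<alpha> B i = (fst (box_at \<alpha> B q) + dr, snd (box_at \<alpha> B q) + dc)"
    using box_sum_pos[of q \<alpha> B] q(2) assms by (simp add: box_at_def assms(2)[symmetric])
  with False show ?thesis by (simp add: extend_def last_map q_def)
qed

text \<open>The loop invariant of the procedure. A step adds to the height the cuts of \<beta>
  strictly inside the current part, none of which is a partial sum of \<alpha>; a cut of \<beta> at
  a boundary between two parts is counted on neither side.\<close>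

lemma ribbon_run_prefix:
  assumes \<alpha>: "is_composition \<alpha>" and \<beta>: "is_composition \<beta>" and n: "sum_list \<alpha> = sum_list \<beta>"
    and "i \<le> length \<alpha>"
  shows "fold (ribbon_step \<beta> \<alpha>) [0..<i] (0, ribbon \<beta>, \<lambda>_. []) =
    (int (card {g \<in> comp_subset \<beta> - comp_subset \<alpha>. g < sum_list (take i \<alpha>)}),
     drop (sum_list (take i \<alpha>)) (ribbon \<beta>),
     \<lambda>j. map (box_at \<alpha> (comp_subset \<beta>)) (filter (\<lambda>p. \<alpha> ! p = j) [0..<i]))"
  using assms(4)
proof (induction i)
  case (Suc i)
  let ?B = "comp_subset \<beta>" and ?s = "sum_list (take i \<alpha>)" and ?a = "\<alpha> ! i"
  let ?D = "\<lambda>i j. map (box_at \<alpha> ?B) (filter (\<lambda>p. \<alpha> ! p = j) [0..<i])"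
  have i: "i < length \<alpha>" using Suc.prems by simp
  have s: "sum_list (take (Suc i) \<alpha>) = ?s + ?a" using i by (simp add: take_Suc_conv_app_nth)
  have bound: "?s + ?a \<le> sum_list \<beta>"
    using partial_sum_mono[of "Suc i" "length \<alpha>" \<alpha>] i s n by simp
  have a: "0 < ?a" using partial_sum_less[OF \<alpha>, of i "Suc i"] i s by simp
  have "{g \<in> ?B - comp_subset \<alpha>. g < ?s + ?a} =
      {g \<in> ?B - comp_subset \<alpha>. g < ?s} \<union> {g \<in> ?B. ?s < g \<and> g < ?s + ?a}"
  proof -
    have inner: "g \<notin> comp_subset \<alpha>" if "?s < g" "g < ?s + ?a" for g
    proof
      assume "g \<in> comp_subset \<alpha>"
      then obtain k where k: "g = sum_list (take k \<alpha>)" by (auto simp: comp_subset_def)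
      show False
        using that partial_sum_mono[of k i \<alpha>] partial_sum_mono[of "Suc i" k \<alpha>] unfolding s k by linarith
    qed
    \<comment> \<open>For \<open>i = 0\<close> the boundary is 0, which is not in the subset of
      \<alpha> but cannot be a cut of \<beta> either.\<close>
    have start: "?s \<in> comp_subset \<alpha> \<or> ?s \<notin> ?B"
      using i comp_subset_bounds[OF \<beta>] unfolding comp_subset_image[of \<alpha>] by (cases "i = 0") auto
    show ?thesis
    proof (rule set_eqI)
      fix g
      consider "g < ?s" | "g = ?s" | "?s < g" by linarith
      then show "g \<in> {g \<in> ?B - comp_subset \<alpha>. g < ?s + ?a} \<longleftrightarrow>
          g \<in> {g \<in> ?B - comp_subset \<alpha>. g < ?s} \<union> {g \<in> ?B. ?s < g \<and> g < ?s + ?a}"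
        by cases (use inner[of g] start in auto)
    qed
  qed
  then have ht: "card {g \<in> ?B - comp_subset \<alpha>. g < ?s + ?a} =
      card {g \<in> ?B - comp_subset \<alpha>. g < ?s} + card {g \<in> ?B. ?s < g \<and> g < ?s + ?a}"
    by (simp add: card_Un_disjoint disjoint_iff)
  have h: "card (fst ` set (take ?a (drop ?s (ribbon \<beta>)))) = Suc (card {g \<in> ?B. ?s < g \<and> g < ?s + ?a})"
    using rows_of_ribbon_segment[OF \<beta> a bound] .
  \<comment> \<open>For \<open>i = 0\<close> the test on the remaining ribbon would succeed with
    \<open>j = 0\<close>, although 0 is not a cut; the procedure decides that case before the
    test.\<close>
  have cut: "(\<exists>j<length \<beta>. \<exists>r c. drop ?s (ribbon \<beta>) = ribbon_at r c (drop j \<beta>)) \<longleftrightarrow> ?s \<in> ?B" if "i \<noteq> 0"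
    using drop_ribbon_is_ribbon_iff[OF \<beta>, of ?s] partial_sum_less[OF \<alpha>, of 0 i] i that bound a by simp
  have "(if i = 0 \<or> \<alpha> ! (i - 1) \<noteq> ?a then extend 1 1 (?D i ?a)
         else if \<exists>j<length \<beta>. \<exists>r c. drop ?s (ribbon \<beta>) = ribbon_at r c (drop j \<beta>) then extend 1 0 (?D i ?a)
         else extend 0 1 (?D i ?a)) =
        extend (fst (box_step \<alpha> ?B i)) (snd (box_step \<alpha> ?B i)) (?D i ?a)"
    using cut by (auto simp: box_step_def)
  also have "\<dots> = ?D (Suc i) ?a" using i by (intro extend_box_at) auto
  finally have D: "(if i = 0 \<or> \<alpha> ! (i - 1) \<noteq> ?a then extend 1 1 (?D i ?a)
         else if \<exists>j<length \<beta>. \<exists>r c. drop ?s (ribbon \<beta>) = ribbon_at r c (drop j \<beta>) then extend 1 0 (?D i ?a)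
         else extend 0 1 (?D i ?a)) = ?D (Suc i) ?a" .
  have "ribbon_step \<beta> \<alpha> i (int (card {g \<in> ?B - comp_subset \<alpha>. g < ?s}), drop ?s (ribbon \<beta>), ?D i) =
     (int (card {g \<in> ?B - comp_subset \<alpha>. g < ?s + ?a}), drop (?s + ?a) (ribbon \<beta>), (?D i)(?a := ?D (Suc i) ?a))"
    unfolding ribbon_step_def prod.case Let_def D h ht by (simp add: add.commute)
  moreover have "(?D i)(?a := ?D (Suc i) ?a) = ?D (Suc i)" by auto
  ultimately show ?case using Suc.IH i s by simp
qed simp

text \<open>All cuts of \<beta> lie below the total, so the final state of the invariant counts
  every cut outside \<alpha>. In particular the height is nonnegative and the integer power in the
  theorem is an ordinary one.\<close>

lemma ribbon_ht_eq:
  assumes "is_composition \<alpha>" "is_composition \<beta>" "sum_list \<alpha> = sum_list \<beta>"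
  shows "ribbon_ht \<beta> \<alpha> = int (card (comp_subset \<beta> - comp_subset \<alpha>))"
proof -
  have "{g \<in> comp_subset \<beta> - comp_subset \<alpha>. g < sum_list \<beta>} = comp_subset \<beta> - comp_subset \<alpha>"
    using comp_subset_bounds[OF assms(2)] by auto
  then show ?thesis
    using ribbon_run_prefix[OF assms order_refl] assms(3) by (simp add: ribbon_ht_def ribbon_run_def)
qed

lemma ribbon_tuple_eq:
  assumes "is_composition \<alpha>" "is_composition \<beta>" "sum_list \<alpha> = sum_list \<beta>"
  shows "ribbon_tuple \<beta> \<alpha> j =
    map (box_at \<alpha> (comp_subset \<beta>)) (filter (\<lambda>p. \<alpha> ! p = j) [0..<length \<alpha>])"
  using ribbon_run_prefix[OF assms order_refl] by (simp add: ribbon_tuple_def ribbon_run_def)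

section \<open>Standard fillings as fillings with prescribed descents\<close>

text \<open>The standard fillings of the ribbon for \<open>j\<close>, read as functions on
  positions. In contrast to \<open>cut_fillings\<close>, the elements of \<open>B\<close> force
  descents.\<close>

definition descent_fillings :: "nat list \<Rightarrow> nat set \<Rightarrow> nat \<Rightarrow> (nat \<Rightarrow> nat) set" where
  "descent_fillings \<alpha> B j = {w \<in> extensional (positions \<alpha> j).
     bij_betw w (positions \<alpha> j) {1..count_list \<alpha> j} \<and>
     (\<forall>p. p \<in> positions \<alpha> j \<and> Suc p \<in> positions \<alpha> j \<longrightarrow>
        (w (Suc p) < w p \<longleftrightarrow> sum_list (take (Suc p) \<alpha>) \<in> B))}"

lemma box_at_eq_iff:
  assumes "p < length \<alpha>" "q < length \<alpha>"
  shows "fst (box_at \<alpha> B p) = fst (box_at \<alpha> B q) \<longleftrightarrow>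
      box_sum \<alpha> (fst \<circ> box_step \<alpha> B) p = box_sum \<alpha> (fst \<circ> box_step \<alpha> B) q"
    and "snd (box_at \<alpha> B p) = snd (box_at \<alpha> B q) \<longleftrightarrow>
      box_sum \<alpha> (snd \<circ> box_step \<alpha> B) p = box_sum \<alpha> (snd \<circ> box_step \<alpha> B) q"
    and "fst (box_at \<alpha> B p) < fst (box_at \<alpha> B q) \<longleftrightarrow>
      box_sum \<alpha> (fst \<circ> box_step \<alpha> B) p < box_sum \<alpha> (fst \<circ> box_step \<alpha> B) q"
    and "snd (box_at \<alpha> B p) < snd (box_at \<alpha> B q) \<longleftrightarrow>
      box_sum \<alpha> (snd \<circ> box_step \<alpha> B) p < box_sum \<alpha> (snd \<circ> box_step \<alpha> B) q"
  using box_sum_pos[OF assms(1), of B] box_sum_pos[OF assms(2), of B]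
  by (auto simp: box_at_def)

lemma box_sum_mono:
  assumes "p \<in> positions \<alpha> j" "q \<in> positions \<alpha> j" "p \<le> q"
  shows "box_sum \<alpha> d p \<le> box_sum \<alpha> d q"
  using assms box_sum_eq[of p q \<alpha> d] by (cases "p = q") (auto simp: positions_def)

lemma box_sum_step:
  assumes "p \<in> positions \<alpha> j" "q \<in> positions \<alpha> j" "p < q"
  shows "box_sum \<alpha> d p + d q \<le> box_sum \<alpha> d q"
proof -
  have "d q \<le> (\<Sum>r | r \<in> positions \<alpha> (\<alpha> ! q) \<and> p < r \<and> r \<le> q. d r)"
    using assms by (intro member_le_sum) (auto simp: positions_def)
  then show ?thesis using assms box_sum_eq[of p q \<alpha> d] by (auto simp: positions_def)
qed

text \<open>No step decreases a coordinate, and every step increases at least one.\<close>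

lemma inj_on_box_at: "inj_on (box_at \<alpha> B) (positions \<alpha> j)"
proof (rule linorder_inj_onI')
  fix p q assume pq: "p \<in> positions \<alpha> j" "q \<in> positions \<alpha> j" "p < q"
  then have "p < length \<alpha>" "q < length \<alpha>" by (auto simp: positions_def)
  note iff = box_at_eq_iff[OF this, of B]
  have "0 < fst (box_step \<alpha> B q) \<or> 0 < snd (box_step \<alpha> B q)" by (auto simp: box_step_def)
  then show "box_at \<alpha> B p \<noteq> box_at \<alpha> B q"
    using box_sum_step[OF pq, of "fst \<circ> box_step \<alpha> B"] box_sum_step[OF pq, of "snd \<circ> box_step \<alpha> B"]
      iff(1,2) by fastforce
qed

text \<open>A coordinate that agrees at \<open>p\<close> and \<open>q\<close> is constant in
  between, and a zero step occurs only directly after an equal part. So a row or column can be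
  walked back one position at a time.\<close>

lemma box_sum_zero_step:
  assumes "p \<in> positions \<alpha> j" "q \<in> positions \<alpha> j" "p < q"
    and "box_sum \<alpha> d p = box_sum \<alpha> d q" and d: "d q = 0 \<Longrightarrow> q \<noteq> 0 \<and> \<alpha> ! (q - 1) = \<alpha> ! q"
  shows "d q = 0" "q - 1 \<in> positions \<alpha> j" "box_sum \<alpha> d p = box_sum \<alpha> d (q - 1)"
proof -
  show "d q = 0" using box_sum_step[OF assms(1-3), of d] assms(4) by simp
  from d[OF this] show q: "q - 1 \<in> positions \<alpha> j" using assms(2) by (auto simp: positions_def)
  then show "box_sum \<alpha> d p = box_sum \<alpha> d (q - 1)"
    using box_sum_mono[OF assms(1) q, of d] box_sum_mono[OF q assms(2), of d] assms(3,4) by simp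
qed

text \<open>Two boxes of one row are joined by east steps between adjacent equal parts, and
  \<open>w\<close> increases along each of them. Columns are treated in the same way with south
  steps.\<close>

lemma same_row_increasing:
  assumes "box_sum \<alpha> (fst \<circ> box_step \<alpha> B) p = box_sum \<alpha> (fst \<circ> box_step \<alpha> B) q"
    and "p \<in> positions \<alpha> j" "q \<in> positions \<alpha> j" "p < q"
    and w: "\<And>p. p \<in> positions \<alpha> j \<Longrightarrow> Suc p \<in> positions \<alpha> j \<Longrightarrow>
      sum_list (take (Suc p) \<alpha>) \<notin> B \<Longrightarrow> (w p :: nat) < w (Suc p)"
  shows "w p < w q"
  using assms(1-4)
proof (induction q)
  case (Suc q)
  let ?d = "fst \<circ> box_step \<alpha> B"
  have d: "?d (Suc q) = 0 \<Longrightarrow> \<alpha> ! q = \<alpha> ! Suc q \<and> sum_list (take (Suc q) \<alpha>) \<notin> B"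
    by (auto simp: box_step_def split: if_splits)
  note z = box_sum_zero_step[OF Suc.prems(2,3,4,1)]
  have z: "?d (Suc q) = 0" "q \<in> positions \<alpha> j" "box_sum \<alpha> ?d p = box_sum \<alpha> ?d q"
    using z d by (auto simp: o_def)
  with d Suc.prems w have "w q < w (Suc q)" by blast
  then show ?case using Suc.IH[OF z(3) Suc.prems(2) z(2)] Suc.prems(4) by (cases "p = q") auto
qed simp

lemma same_column_decreasing:
  assumes "box_sum \<alpha> (snd \<circ> box_step \<alpha> B) p = box_sum \<alpha> (snd \<circ> box_step \<alpha> B) q"
    and "p \<in> positions \<alpha> j" "q \<in> positions \<alpha> j" "p < q"
    and w: "\<And>p. p \<in> positions \<alpha> j \<Longrightarrow> Suc p \<in> positions \<alpha> j \<Longrightarrow>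
      sum_list (take (Suc p) \<alpha>) \<in> B \<Longrightarrow> w (Suc p) < (w p :: nat)"
  shows "w q < w p"
  using assms(1-4)
proof (induction q)
  case (Suc q)
  let ?d = "snd \<circ> box_step \<alpha> B"
  have d: "?d (Suc q) = 0 \<Longrightarrow> \<alpha> ! q = \<alpha> ! Suc q \<and> sum_list (take (Suc q) \<alpha>) \<in> B"
    by (auto simp: box_step_def split: if_splits)
  note z = box_sum_zero_step[OF Suc.prems(2,3,4,1)]
  have z: "?d (Suc q) = 0" "q \<in> positions \<alpha> j" "box_sum \<alpha> ?d p = box_sum \<alpha> ?d q"
    using z d by (auto simp: o_def)
  with d Suc.prems w have "w (Suc q) < w q" by blast
  then show ?case using Suc.IH[OF z(3) Suc.prems(2) z(2)] Suc.prems(4) by (cases "p = q") auto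
qed simp

text \<open>Rows and columns are chains of east and south steps, so the order conditions reduce to
  neighbouring boxes: an ascent for an east step, a descent for a south step. Injectivity turns the
  absence of a descent into an ascent.\<close>

lemma ribbon_conditions_iff_descents:
  fixes w :: "nat \<Rightarrow> nat"
  assumes "inj_on w (positions \<alpha> j)"
  shows "((\<forall>p\<in>positions \<alpha> j. \<forall>q\<in>positions \<alpha> j.
        fst (box_at \<alpha> B p) = fst (box_at \<alpha> B q) \<and> snd (box_at \<alpha> B p) < snd (box_at \<alpha> B q) \<longrightarrow> w p < w q) \<and>
      (\<forall>p\<in>positions \<alpha> j. \<forall>q\<in>positions \<alpha> j.
        snd (box_at \<alpha> B p) = snd (box_at \<alpha> B q) \<and> fst (box_at \<alpha> B p) < fst (box_at \<alpha> B q) \<longrightarrow> w p > w q)) \<longleftrightarrow>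
    (\<forall>p. p \<in> positions \<alpha> j \<and> Suc p \<in> positions \<alpha> j \<longrightarrow>
        (w (Suc p) < w p \<longleftrightarrow> sum_list (take (Suc p) \<alpha>) \<in> B))"
    (is "?row \<and> ?col \<longleftrightarrow> ?desc")
proof
  let ?I = "positions \<alpha> j" and ?d1 = "fst \<circ> box_step \<alpha> B" and ?d2 = "snd \<circ> box_step \<alpha> B"
  have len: "p \<in> ?I \<Longrightarrow> p < length \<alpha>" for p by (simp add: positions_def)
  {
    assume rc: "?row \<and> ?col"
    show ?desc
    proof (intro allI impI)
      fix p assume p: "p \<in> ?I \<and> Suc p \<in> ?I"
      then have \<alpha>: "\<alpha> ! p = \<alpha> ! Suc p" by (simp add: positions_def)
      have sums: "box_sum \<alpha> d (Suc p) = box_sum \<alpha> d p + d (Suc p)" for d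
        using p \<alpha> by (intro box_sum_consecutive) (auto simp: positions_def)
      note iff = box_at_eq_iff[OF len len, of p "Suc p"]
      show "w (Suc p) < w p \<longleftrightarrow> sum_list (take (Suc p) \<alpha>) \<in> B"
      proof (cases "sum_list (take (Suc p) \<alpha>) \<in> B")
        case True
        then have "box_step \<alpha> B (Suc p) = (1, 0)" using \<alpha> by (simp add: box_step_def)
        then have "snd (box_at \<alpha> B p) = snd (box_at \<alpha> B (Suc p))" "fst (box_at \<alpha> B p) < fst (box_at \<alpha> B (Suc p))"
          using p sums[of ?d1] sums[of ?d2] by (simp_all add: iff)
        with rc p True show ?thesis by blast
      next
        case False
        then have "box_step \<alpha> B (Suc p) = (0, 1)" using \<alpha> by (simp add: box_step_def)
        then have "fst (box_at \<alpha> B p) = fst (box_at \<alpha> B (Suc p))" "snd (box_at \<alpha> B p) < snd (box_at \<alpha> B (Suc p))"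
          using p sums[of ?d1] sums[of ?d2] by (simp_all add: iff)
        then have "w p < w (Suc p)" using rc p by blast
        with False show ?thesis by simp
      qed
    qed
  }
  {
    assume desc: ?desc
    have down: "w (Suc p) < w p" if "p \<in> ?I" "Suc p \<in> ?I" "sum_list (take (Suc p) \<alpha>) \<in> B" for p
      using desc that by blast
    have up: "w p < w (Suc p)" if "p \<in> ?I" "Suc p \<in> ?I" "sum_list (take (Suc p) \<alpha>) \<notin> B" for p
    proof -
      have "w p \<noteq> w (Suc p)" using inj_onD[OF assms _ that(1,2)] by auto
      with desc that show ?thesis by (meson linorder_neqE_nat)
    qed
    show "?row \<and> ?col"
    proof (intro conjI ballI impI)
      fix p q assume p: "p \<in> ?I" and q: "q \<in> ?I"
      note iff = box_at_eq_iff[OF len[OF p] len[OF q], of B]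
      {
        assume *: "fst (box_at \<alpha> B p) = fst (box_at \<alpha> B q) \<and> snd (box_at \<alpha> B p) < snd (box_at \<alpha> B q)"
        \<comment> \<open>Coordinates never decrease along a ribbon, so the box further left was
          added earlier.\<close>
        then have less: "p < q" using box_sum_mono[OF q p, of ?d2] iff(4) by (meson leD not_le)
        have sum_eq: "box_sum \<alpha> ?d1 p = box_sum \<alpha> ?d1 q" using * iff(1) by blast
        show "w p < w q" by (rule same_row_increasing[OF sum_eq p q less]) (rule up)
      next
        assume *: "snd (box_at \<alpha> B p) = snd (box_at \<alpha> B q) \<and> fst (box_at \<alpha> B p) < fst (box_at \<alpha> B q)"
        then have less: "p < q" using box_sum_mono[OF q p, of ?d1] iff(3) by (meson leD not_le)
        have sum_eq: "box_sum \<alpha> ?d2 p = box_sum \<alpha> ?d2 q" using * iff(2) by blast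
        show "w q < w p" by (rule same_column_decreasing[OF sum_eq p q less]) (rule down)
      }
    qed
  }
qed

text \<open>Transport of extensional functions along the bijection \<open>b\<close>; the inverse map
  composes with the inverse of \<open>b\<close>.\<close>

lemma bij_betw_restrict_comp:
  assumes "bij_betw b I J"
    and mem: "\<And>f. f \<in> extensional J \<Longrightarrow> P f \<longleftrightarrow> Q (restrict (f \<circ> b) I)"
  shows "bij_betw (\<lambda>f. restrict (f \<circ> b) I) {f \<in> extensional J. P f} {w \<in> extensional I. Q w}"
proof (rule bij_betw_imageI)
  have J: "J = b ` I" using assms(1) by (simp add: bij_betw_def)
  show "inj_on (\<lambda>f. restrict (f \<circ> b) I) {f \<in> extensional J. P f}"
  proof (rule inj_onI)
    fix f g assume fg: "f \<in> {f \<in> extensional J. P f}" "g \<in> {f \<in> extensional J. P f}"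
      "restrict (f \<circ> b) I = restrict (g \<circ> b) I"
    have "f (b p) = g (b p)" if "p \<in> I" for p
      using fun_cong[OF fg(3), of p] that by simp
    with fg J show "f = g" by (intro extensionalityI[of f J g]) auto
  qed
  show "(\<lambda>f. restrict (f \<circ> b) I) ` {f \<in> extensional J. P f} = {w \<in> extensional I. Q w}"
  proof
    show "{w \<in> extensional I. Q w} \<subseteq> (\<lambda>f. restrict (f \<circ> b) I) ` {f \<in> extensional J. P f}"
    proof
      fix w assume w: "w \<in> {w \<in> extensional I. Q w}"
      define f where "f = restrict (w \<circ> the_inv_into I b) J"
      have "f (b p) = w p" if "p \<in> I" for p
        using assms(1) that by (simp add: f_def J bij_betw_def the_inv_into_f_f)
      then have "restrict (f \<circ> b) I = w"
        using w by (intro extensionalityI[of _ I]) auto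
      moreover have "f \<in> extensional J" by (simp add: f_def)
      ultimately show "w \<in> (\<lambda>f. restrict (f \<circ> b) I) ` {f \<in> extensional J. P f}"
        using w mem by (intro image_eqI[of _ _ f]) auto
    qed
  qed (use mem in auto)
qed

text \<open>Moves a condition quantified over coordinates, as in \<open>standard_fillings\<close>,
  to the positions that index the boxes.\<close>

lemma ball_image_same_row:
  "(\<forall>r c c'. (r, c) \<in> b ` I \<and> (r, c') \<in> b ` I \<and> P c c' \<longrightarrow> Q (r, c) (r, c')) \<longleftrightarrow>
   (\<forall>p\<in>I. \<forall>q\<in>I. fst (b p) = fst (b q) \<and> P (snd (b p)) (snd (b q)) \<longrightarrow> Q (b p) (b q))"
  (is "?L \<longleftrightarrow> ?R")
proof
  assume L: ?L
  show ?R
  proof (intro ballI impI)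
    fix p q assume pq: "p \<in> I" "q \<in> I" "fst (b p) = fst (b q) \<and> P (snd (b p)) (snd (b q))"
    have "(fst (b p), snd (b p)) = b p" "(fst (b p), snd (b q)) = b q" using pq by (simp_all add: prod_eq_iff)
    with L[rule_format, of "fst (b p)" "snd (b p)" "snd (b q)"] pq show "Q (b p) (b q)" by simp
  qed
next
  assume R: ?R
  show ?L
  proof (intro allI impI, elim conjE imageE)
    fix r c c' p q assume "(r, c) = b p" "(r, c') = b q" "P c c'" "p \<in> I" "q \<in> I"
    then show "Q (r, c) (r, c')" using R[rule_format, of p q] by (metis fst_conv snd_conv)
  qed
qed

lemma ball_image_same_col:
  "(\<forall>r r' c. (r, c) \<in> b ` I \<and> (r', c) \<in> b ` I \<and> P r r' \<longrightarrow> Q (r, c) (r', c)) \<longleftrightarrow>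
   (\<forall>p\<in>I. \<forall>q\<in>I. snd (b p) = snd (b q) \<and> P (fst (b p)) (fst (b q)) \<longrightarrow> Q (b p) (b q))"
  (is "?L \<longleftrightarrow> ?R")
proof
  assume L: ?L
  show ?R
  proof (intro ballI impI)
    fix p q assume pq: "p \<in> I" "q \<in> I" "snd (b p) = snd (b q) \<and> P (fst (b p)) (fst (b q))"
    have "(fst (b p), snd (b p)) = b p" "(fst (b q), snd (b p)) = b q" using pq by (simp_all add: prod_eq_iff)
    with L[rule_format, of "fst (b p)" "snd (b p)" "fst (b q)"] pq show "Q (b p) (b q)" by simp
  qed
next
  assume R: ?R
  show ?L
  proof (intro allI impI, elim conjE imageE)
    fix r r' c p q assume "(r, c) = b p" "(r', c) = b q" "P r r'" "p \<in> I" "q \<in> I"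
    then show "Q (r, c) (r', c)" using R[rule_format, of p q] by (metis fst_conv snd_conv)
  qed
qed

text \<open>The bijection is composition with \<open>box_at\<close>, which reads the entries of a
  filling in the order of the positions.\<close>

lemma card_standard_fillings:
  assumes "is_composition \<alpha>" "is_composition \<beta>" "sum_list \<alpha> = sum_list \<beta>"
  shows "card (standard_fillings (ribbon_tuple \<beta> \<alpha> j)) = card (descent_fillings \<alpha> (comp_subset \<beta>) j)"
proof -
  let ?B = "comp_subset \<beta>" and ?I = "positions \<alpha> j"
  let ?b = "box_at \<alpha> ?B" and ?R = "ribbon_tuple \<beta> \<alpha> j"
  have set: "set ?R = ?b ` ?I" by (auto simp: ribbon_tuple_eq[OF assms] positions_def)
  have len: "length ?R = count_list \<alpha> j"
    unfolding ribbon_tuple_eq[OF assms] card_positions[symmetric] positions_def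
    by (simp add: length_filter_conv_card cong: conj_cong)
  have b: "bij_betw ?b ?I (set ?R)" unfolding set by (rule inj_on_imp_bij_betw[OF inj_on_box_at])
  have "bij_betw (\<lambda>f. restrict (f \<circ> ?b) ?I) (standard_fillings ?R) (descent_fillings \<alpha> ?B j)"
    unfolding standard_fillings_def descent_fillings_def
  proof (rule bij_betw_restrict_comp[OF b])
    fix f :: "box \<Rightarrow> nat"
    let ?w = "restrict (f \<circ> ?b) ?I"
    have bij: "bij_betw f (set ?R) {1..length ?R} \<longleftrightarrow> bij_betw ?w ?I {1..count_list \<alpha> j}"
      unfolding len bij_betw_restrict_eq using bij_betw_comp_iff[OF b] by blast
    have row: "(\<forall>r c c'. (r, c) \<in> set ?R \<and> (r, c') \<in> set ?R \<and> c < c' \<longrightarrow> f (r, c) < f (r, c')) \<longleftrightarrow>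
        (\<forall>p\<in>?I. \<forall>q\<in>?I. fst (?b p) = fst (?b q) \<and> snd (?b p) < snd (?b q) \<longrightarrow> ?w p < ?w q)"
      unfolding set
      using ball_image_same_row[of ?b ?I "(<)" "\<lambda>x y. f x < f y"] by simp
    have col: "(\<forall>r r' c. (r, c) \<in> set ?R \<and> (r', c) \<in> set ?R \<and> r < r' \<longrightarrow> f (r, c) > f (r', c)) \<longleftrightarrow>
        (\<forall>p\<in>?I. \<forall>q\<in>?I. snd (?b p) = snd (?b q) \<and> fst (?b p) < fst (?b q) \<longrightarrow> ?w p > ?w q)"
      unfolding set
      using ball_image_same_col[of ?b ?I "(<)" "\<lambda>x y. f x > f y"] by simp
    show "(bij_betw f (set ?R) {1..length ?R} \<and>
        (\<forall>r c c'. (r, c) \<in> set ?R \<and> (r, c') \<in> set ?R \<and> c < c' \<longrightarrow> f (r, c) < f (r, c')) \<and>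
        (\<forall>r r' c. (r, c) \<in> set ?R \<and> (r', c) \<in> set ?R \<and> r < r' \<longrightarrow> f (r, c) > f (r', c))) \<longleftrightarrow>
      (bij_betw ?w ?I {1..count_list \<alpha> j} \<and>
        (\<forall>p. p \<in> ?I \<and> Suc p \<in> ?I \<longrightarrow> (?w (Suc p) < ?w p \<longleftrightarrow> sum_list (take (Suc p) \<alpha>) \<in> ?B)))"
      unfolding row col bij
      by (rule conj_cong[OF refl]) (rule ribbon_conditions_iff_descents[OF bij_betw_imp_inj_on])
  qed
  then show ?thesis by (rule bij_betw_same_card)
qed

section \<open>The expansion in fundamental quasisymmetric functions\<close>

lemma ascents_subset: "ascents prec \<alpha> \<subseteq> comp_subset \<alpha>"
  by (auto simp: ascents_def comp_subset_def)

lemma T_comp: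
  assumes "is_composition \<alpha>"
  shows "is_composition (T_comp prec \<alpha>)" "sum_list (T_comp prec \<alpha>) = sum_list \<alpha>"
    "comp_subset (T_comp prec \<alpha>) =
      ascents prec \<alpha> \<union> ({1..<sum_list \<alpha>} - strict_descents prec \<alpha>)"
proof -
  have "ascents prec \<alpha> \<union> ({1..<sum_list \<alpha>} - strict_descents prec \<alpha>) \<subseteq> {1..<sum_list \<alpha>}"
    using ascents_subset comp_subset_bounds[OF assms] by blast
  from comp_of_subset[OF this]
  show "is_composition (T_comp prec \<alpha>)" "sum_list (T_comp prec \<alpha>) = sum_list \<alpha>"
    "comp_subset (T_comp prec \<alpha>) =
      ascents prec \<alpha> \<union> ({1..<sum_list \<alpha>} - strict_descents prec \<alpha>)"
    by (simp_all add: T_comp_def comp_subset_C_comp)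
qed

section \<open>Families of fillings, one filling for each part size\<close>

lemma finite_descent_fillings: "finite (descent_fillings \<alpha> B j)"
proof (rule finite_subset)
  show "descent_fillings \<alpha> B j \<subseteq> positions \<alpha> j \<rightarrow>\<^sub>E {1..count_list \<alpha> j}"
    by (auto simp: descent_fillings_def PiE_def bij_betw_def)
qed (simp add: finite_PiE)

definition descent_families :: "nat list \<Rightarrow> nat set \<Rightarrow> (nat \<Rightarrow> nat \<Rightarrow> nat) set" where
  "descent_families \<alpha> B = (\<Pi>\<^sub>E j\<in>{1..sum_list \<alpha>}. descent_fillings \<alpha> B j)"

definition cut_families :: "nat list \<Rightarrow> nat set \<Rightarrow> (nat \<Rightarrow> nat \<Rightarrow> nat) set" where
  "cut_families \<alpha> G = (\<Pi>\<^sub>E j\<in>{1..sum_list \<alpha>}. cut_fillings \<alpha> G j)"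

lemma card_SDR:
  assumes "is_composition \<alpha>" "is_composition \<beta>" "sum_list \<alpha> = sum_list \<beta>"
  shows "card (SDR \<beta> \<alpha>) = card (descent_families \<alpha> (comp_subset \<beta>))"
  by (simp add: SDR_def descent_families_def card_PiE card_standard_fillings[OF assms])

text \<open>Descents are tested only at partial sums of \<alpha>, so other elements of
  \<open>B\<close> are invisible to the fillings. This is why toggling such an element changes only
  the sign.\<close>

lemma descent_families_cong:
  assumes "B \<inter> comp_subset \<alpha> = B' \<inter> comp_subset \<alpha>"
  shows "descent_families \<alpha> B = descent_families \<alpha> B'"
proof -
  have "sum_list (take (Suc p) \<alpha>) \<in> B \<longleftrightarrow> sum_list (take (Suc p) \<alpha>) \<in> B'" if "Suc p \<in> positions \<alpha> j" for p j
  proof -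
    have "sum_list (take (Suc p) \<alpha>) \<in> comp_subset \<alpha>"
      using that by (auto simp: positions_def comp_subset_def)
    then show ?thesis using assms by blast
  qed
  then have "descent_fillings \<alpha> B j = descent_fillings \<alpha> B' j" for j
    unfolding descent_fillings_def by blast
  then show ?thesis by (simp add: descent_families_def)
qed

text \<open>The candidate for the set \<open>B\<close> to which a family \<open>F\<close> belongs,
  recovered from \<open>F\<close> alone. The ascents of \<alpha> are put in because every
  \<open>B\<close> in the sum contains them.\<close>

definition family_descents :: "(nat \<Rightarrow> nat \<Rightarrow> bool) \<Rightarrow> nat list \<Rightarrow> (nat \<Rightarrow> nat \<Rightarrow> nat) \<Rightarrow> nat set" where
  "family_descents prec \<alpha> F = ascents prec \<alpha> \<union> {sum_list (take (Suc p) \<alpha>) | p.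
     Suc p < length \<alpha> \<and> \<alpha> ! p = \<alpha> ! Suc p \<and> F (\<alpha> ! p) (Suc p) < F (\<alpha> ! p) p}"

lemma part_in_range: "is_composition \<alpha> \<Longrightarrow> p < length \<alpha> \<Longrightarrow> \<alpha> ! p \<in> {1..sum_list \<alpha>}"
  using member_le_sum_list[of "\<alpha> ! p" \<alpha>] nth_mem[of p \<alpha>]
  by (cases "\<alpha> ! p") (auto simp: is_composition_def)

text \<open>An element of \<open>B\<close> that is not an ascent is a partial sum of \<alpha>, and
  \<open>T_comp\<close> excludes strict descents. By totality the adjacent parts are equal, so the
  element shows up as a descent of \<open>F\<close>. Families for different \<open>B\<close> are
  therefore disjoint.\<close>

lemma descent_families_determine:
  assumes ord: "totalp_on {0<..} prec" and \<alpha>: "is_composition \<alpha>"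
    and B: "ascents prec \<alpha> \<subseteq> B" "B \<subseteq> comp_subset \<alpha> \<inter> comp_subset (T_comp prec \<alpha>)"
    and F: "F \<in> descent_families \<alpha> B"
  shows "B = family_descents prec \<alpha> F"
proof -
  have F_desc: "F (\<alpha> ! p) (Suc p) < F (\<alpha> ! p) p \<longleftrightarrow> sum_list (take (Suc p) \<alpha>) \<in> B"
    if "Suc p < length \<alpha>" "\<alpha> ! p = \<alpha> ! Suc p" for p
  proof -
    have "F (\<alpha> ! p) \<in> descent_fillings \<alpha> B (\<alpha> ! p)"
      using F part_in_range[OF \<alpha>, of p] that by (auto simp: descent_families_def)
    then show ?thesis using that by (simp add: descent_fillings_def positions_def)
  qed
  have "x \<in> family_descents prec \<alpha> F" if x: "x \<in> B" for x
  proof (cases "x \<in> ascents prec \<alpha>")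
    case False
    obtain i where i: "1 \<le> i" "i < length \<alpha>" "x = sum_list (take i \<alpha>)"
      using x B(2) by (auto simp: comp_subset_def)
    then obtain p where p: "i = Suc p" by (cases i) auto
    have "\<not> prec (\<alpha> ! p) (\<alpha> ! Suc p)" using False i p by (auto simp: ascents_def)
    moreover have "x \<notin> strict_descents prec \<alpha>" using B(2) x False T_comp(3)[OF \<alpha>] by blast
    then have "\<not> prec (\<alpha> ! Suc p) (\<alpha> ! p)" using i p by (auto simp: strict_descents_def)
    ultimately have "\<alpha> ! p = \<alpha> ! Suc p"
      using totalp_onD[OF ord, of "\<alpha> ! p" "\<alpha> ! Suc p"] part_in_range[OF \<alpha>, of p] part_in_range[OF \<alpha>, of "Suc p"] i p
      by auto
    with F_desc[of p] i p x show ?thesis by (auto simp: family_descents_def)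
  qed (simp add: family_descents_def)
  moreover have "family_descents prec \<alpha> F \<subseteq> B"
    using B(1) F_desc by (auto simp: family_descents_def)
  ultimately show ?thesis by blast
qed

text \<open>Sorts the families by their exact set of descents, with \<open>family_descents\<close>
  as the witness. By irreflexivity a boundary between equal parts is neither an ascent nor a strict
  descent, so the witness lies within \<open>T_comp\<close>.\<close>

lemma cut_families_eq_Union:
  assumes ord: "irreflp_on {0<..} prec" "totalp_on {0<..} prec" and \<alpha>: "is_composition \<alpha>"
    and G: "ascents prec \<alpha> \<subseteq> G" "G \<subseteq> comp_subset \<alpha>"
  shows "cut_families \<alpha> G =
    (\<Union>B\<in>{B. ascents prec \<alpha> \<subseteq> B \<and> B \<subseteq> G \<inter> comp_subset (T_comp prec \<alpha>)}. descent_families \<alpha> B)"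
proof (intro equalityI subsetI)
  fix F assume F: "F \<in> cut_families \<alpha> G"
  let ?B = "family_descents prec \<alpha> F"
  have irr: "\<not> prec (\<alpha> ! p) (\<alpha> ! p)" if "p < length \<alpha>" for p
    using irreflp_onD[OF ord(1)] part_in_range[OF \<alpha> that] by simp
  have F_cut: "F (\<alpha> ! p) \<in> cut_fillings \<alpha> G (\<alpha> ! p)" if "p < length \<alpha>" for p
    using F part_in_range[OF \<alpha> that] by (auto simp: cut_families_def)
  have sub: "?B \<subseteq> G \<inter> comp_subset (T_comp prec \<alpha>)"
  proof
    fix x assume "x \<in> ?B"
    then consider "x \<in> ascents prec \<alpha>"
      | p where "Suc p < length \<alpha>" "\<alpha> ! p = \<alpha> ! Suc p" "F (\<alpha> ! p) (Suc p) < F (\<alpha> ! p) p"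
          "x = sum_list (take (Suc p) \<alpha>)"
      by (auto simp: family_descents_def)
    then show "x \<in> G \<inter> comp_subset (T_comp prec \<alpha>)"
    proof cases
      case 1
      then show ?thesis using G T_comp(3)[OF \<alpha>] by auto
    next
      case (2 p)
      have "F (\<alpha> ! p) p < F (\<alpha> ! p) (Suc p)" if "x \<notin> G"
        using F_cut[of p] 2 that by (simp add: cut_fillings_def positions_def)
      then have "x \<in> G" using 2 by force
      moreover have "x \<notin> strict_descents prec \<alpha>"
      proof
        assume "x \<in> strict_descents prec \<alpha>"
        then obtain i where i: "1 \<le> i" "i < length \<alpha>" "prec (\<alpha> ! i) (\<alpha> ! (i - 1))" "x = sum_list (take i \<alpha>)"
          unfolding strict_descents_def by blast
        have "i = Suc p"
          using trans[OF i(4)[symmetric] 2(4)] i(2) 2(1)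
          by (metis partial_sum_inj[OF \<alpha>] less_imp_le)
        then show False using irr[of "Suc p"] i(3) 2(1,2) by simp
      qed
      moreover have "x \<in> {1..<sum_list \<alpha>}" using \<open>x \<in> G\<close> G(2) comp_subset_bounds[OF \<alpha>] by blast
      ultimately show ?thesis by (simp add: T_comp(3)[OF \<alpha>])
    qed
  qed
  have "F \<in> descent_families \<alpha> ?B"
    unfolding descent_families_def
  proof (rule PiE_I)
    fix j assume j: "j \<in> {1..sum_list \<alpha>}"
    have "F j (Suc p) < F j p \<longleftrightarrow> sum_list (take (Suc p) \<alpha>) \<in> ?B"
      if p: "p \<in> positions \<alpha> j" "Suc p \<in> positions \<alpha> j" for p
    proof
      assume "F j (Suc p) < F j p"
      then show "sum_list (take (Suc p) \<alpha>) \<in> ?B"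
        unfolding family_descents_def
        by (intro UnI2 CollectI exI[of _ p]) (use p in \<open>simp add: positions_def\<close>)
    next
      assume "sum_list (take (Suc p) \<alpha>) \<in> ?B"
      then consider q where "Suc q < length \<alpha>" "prec (\<alpha> ! q) (\<alpha> ! Suc q)"
            "sum_list (take (Suc p) \<alpha>) = sum_list (take (Suc q) \<alpha>)"
        | q where "Suc q < length \<alpha>" "F (\<alpha> ! q) (Suc q) < F (\<alpha> ! q) q"
            "sum_list (take (Suc p) \<alpha>) = sum_list (take (Suc q) \<alpha>)"
        unfolding family_descents_def ascents_image by blast
      then show "F j (Suc p) < F j p"
      proof cases
        \<comment> \<open>Contradictory case: an ascent cannot lie between two equal parts.\<close>
        case (1 q)
        then have "p = q" using partial_sum_inj[OF \<alpha>, of "Suc p" "Suc q"] p by (simp add: positions_def)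
        then show ?thesis using 1 p irr[of p] by (simp add: positions_def)
      next
        case (2 q)
        then have "p = q" using partial_sum_inj[OF \<alpha>, of "Suc p" "Suc q"] p by (simp add: positions_def)
        then show ?thesis using 2 p by (simp add: positions_def)
      qed
    qed
    then show "F j \<in> descent_fillings \<alpha> ?B j"
      using F j by (auto simp: cut_families_def cut_fillings_def descent_fillings_def)
  qed (use F in \<open>auto simp: cut_families_def\<close>)
  moreover have "ascents prec \<alpha> \<subseteq> ?B" by (simp add: family_descents_def)
  ultimately show "F \<in> (\<Union>B\<in>{B. ascents prec \<alpha> \<subseteq> B \<and> B \<subseteq> G \<inter> comp_subset (T_comp prec \<alpha>)}.
      descent_families \<alpha> B)"
    using sub by blast
next
  fix F assume "F \<in> (\<Union>B\<in>{B. ascents prec \<alpha> \<subseteq> B \<and> B \<subseteq> G \<inter> comp_subset (T_comp prec \<alpha>)}.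
      descent_families \<alpha> B)"
  then obtain B where B: "B \<subseteq> G" "F \<in> descent_families \<alpha> B" by auto
  have "F j \<in> cut_fillings \<alpha> G j" if "j \<in> {1..sum_list \<alpha>}" for j
  proof -
    have Fj: "F j \<in> descent_fillings \<alpha> B j" using B that by (auto simp: descent_families_def)
    then have "F j p < F j (Suc p)"
      if p: "p \<in> positions \<alpha> j" "Suc p \<in> positions \<alpha> j" "sum_list (take (Suc p) \<alpha>) \<notin> G" for p
    proof -
      have "F j p \<noteq> F j (Suc p)"
        using Fj p inj_onD[of "F j" "positions \<alpha> j" p "Suc p"]
        by (auto simp: descent_fillings_def bij_betw_def)
      moreover have "\<not> F j (Suc p) < F j p"
        using Fj p B(1) by (auto simp: descent_fillings_def)
      ultimately show ?thesis by simp
    qed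
    with Fj show ?thesis by (auto simp: descent_fillings_def cut_fillings_def)
  qed
  then show "F \<in> cut_families \<alpha> G"
    using B(2) by (auto simp: cut_families_def descent_families_def PiE_iff)
qed

lemma sum_card_descent_families:
  assumes ord: "irreflp_on {0<..} prec" "totalp_on {0<..} prec" and \<alpha>: "is_composition \<alpha>"
    and G: "ascents prec \<alpha> \<subseteq> G" "G \<subseteq> comp_subset \<alpha>"
  shows "(\<Sum>B | ascents prec \<alpha> \<subseteq> B \<and> B \<subseteq> G \<inter> comp_subset (T_comp prec \<alpha>).
      card (descent_families \<alpha> B)) = card (cut_families \<alpha> G)"
  unfolding cut_families_eq_Union[OF assms]
proof (rule card_UN_disjoint[symmetric])
  have "finite G" using finite_subset[OF G(2)] by simp
  then show "finite {B. ascents prec \<alpha> \<subseteq> B \<and> B \<subseteq> G \<inter> comp_subset (T_comp prec \<alpha>)}"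
    by (rule finite_subset[OF _ finite_Pow_iff[THEN iffD2], rotated]) auto
  show "\<forall>B\<in>{B. ascents prec \<alpha> \<subseteq> B \<and> B \<subseteq> G \<inter> comp_subset (T_comp prec \<alpha>)}.
      finite (descent_families \<alpha> B)"
    by (simp add: descent_families_def finite_PiE finite_descent_fillings)
  have "B = family_descents prec \<alpha> F"
    if "ascents prec \<alpha> \<subseteq> B" "B \<subseteq> G \<inter> comp_subset (T_comp prec \<alpha>)" "F \<in> descent_families \<alpha> B" for B F
    using descent_families_determine[OF ord(2) \<alpha>, of B F] that G(2) by blast
  then show "\<forall>B\<in>{B. ascents prec \<alpha> \<subseteq> B \<and> B \<subseteq> G \<inter> comp_subset (T_comp prec \<alpha>)}.
      \<forall>B'\<in>{B. ascents prec \<alpha> \<subseteq> B \<and> B \<subseteq> G \<inter> comp_subset (T_comp prec \<alpha>)}.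
      B \<noteq> B' \<longrightarrow> descent_families \<alpha> B \<inter> descent_families \<alpha> B' = {}"
    by (intro ballI impI equals0I) (metis (no_types, lifting) IntD1 IntD2 mem_Collect_eq)
qed

section \<open>The coefficients as numbers of families\<close>

lemma card_cut_fillings_absent: "j \<notin> set \<alpha> \<Longrightarrow> card (cut_fillings \<alpha> G j) = 1"
proof -
  assume "j \<notin> set \<alpha>"
  then have "positions \<alpha> j = {}" "count_list \<alpha> j = 0"
    by (auto simp: positions_def count_list_0_iff)
  then have "cut_fillings \<alpha> G j = {\<lambda>_. undefined}" by (auto simp: cut_fillings_def bij_betw_def)
  then show ?thesis by simp
qed

text \<open>Both sides are products over part sizes of the same multinomial coefficients; sizes that
  do not occur in \<alpha> admit exactly one filling and contribute the factor 1.\<close>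

lemma comp_coeff_eq_card_cut_families:
  assumes ord: "irreflp_on {0<..} prec" "transp_on {0<..} prec" "totalp_on {0<..} prec"
    and \<gamma>: "comp_le \<alpha> \<gamma>" "comp_le \<gamma> (C_comp prec \<alpha>)"
  shows "(comp_coeff \<alpha> \<gamma> :: 'a::field_char_0) = of_nat (card (cut_families \<alpha> (comp_subset \<gamma>)))"
proof -
  let ?c = "\<lambda>j. card (cut_fillings \<alpha> (comp_subset \<gamma>) j)"
  have \<alpha>: "is_composition \<alpha>" using \<gamma>(1) by (simp add: comp_le_iff)
  have of_nat_prod_list: "of_nat (\<Prod>b\<leftarrow>bs. fact (count_list b j)) =
      (\<Prod>b\<leftarrow>bs. fact (count_list b j) :: 'a)" for bs :: "nat list list" and j
    by (induction bs) auto
  have quot: "fact (count_list \<alpha> j) / (\<Prod>b\<leftarrow>comp_blocks \<alpha> \<gamma>. fact (count_list b j)) = (of_nat (?c j) :: 'a)" for j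
  proof -
    have "(of_nat (?c j) :: 'a) * (\<Prod>b\<leftarrow>comp_blocks \<alpha> \<gamma>. fact (count_list b j)) = fact (count_list \<alpha> j)"
      using arg_cong[OF card_cut_fillings[OF ord \<gamma>, of j], of "of_nat :: nat \<Rightarrow> 'a"]
      by (simp add: of_nat_prod_list)
    moreover have "(\<Prod>b\<leftarrow>comp_blocks \<alpha> \<gamma>. fact (count_list b j) :: 'a) \<noteq> 0"
      unfolding prod_list_zero_iff set_map by (metis fact_nonzero imageE)
    ultimately show ?thesis by (simp add: nonzero_divide_eq_eq)
  qed
  have "set \<alpha> \<subseteq> {1..sum_list \<alpha>}"
    using part_in_range[OF \<alpha>] by (auto simp: in_set_conv_nth)
  then have "(\<Prod>j\<in>{1..sum_list \<alpha>}. ?c j) = (\<Prod>j\<in>set \<alpha>. ?c j)"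
    by (intro prod.mono_neutral_right) (auto simp: card_cut_fillings_absent)
  then show ?thesis
    by (simp add: comp_coeff_def quot cut_families_def card_PiE)
qed

text \<open>Toggling \<open>x\<close> is a sign-reversing involution on the sets between
  \<open>C\<close> and \<open>X\<close>. The sum equals its own negative and vanishes in
  characteristic 0.\<close>

lemma sum_toggle_zero:
  fixes g :: "'b set \<Rightarrow> 'a::field_char_0"
  assumes "x \<in> X" "x \<notin> C" and g: "\<And>B. x \<notin> B \<Longrightarrow> C \<subseteq> B \<Longrightarrow> B \<subseteq> X \<Longrightarrow> g (insert x B) = - g B"
  shows "(\<Sum>B | C \<subseteq> B \<and> B \<subseteq> X. g B) = 0"
proof -
  let ?t = "\<lambda>B. if x \<in> B then B - {x} else insert x B"
  have "(\<Sum>B | C \<subseteq> B \<and> B \<subseteq> X. g B) = (\<Sum>B | C \<subseteq> B \<and> B \<subseteq> X. - g B)"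
  proof (rule sum.reindex_bij_witness[of _ ?t ?t])
    fix B assume B: "B \<in> {B. C \<subseteq> B \<and> B \<subseteq> X}"
    show "- g (?t B) = g B"
    proof (cases "x \<in> B")
      case True
      have "g (insert x (B - {x})) = - g (B - {x})" using B assms(2) by (intro g) auto
      with True show ?thesis by (simp add: insert_absorb)
    next
      case False
      then show ?thesis using g[of B] B by simp
    qed
  qed (use assms in auto)
  then have "(\<Sum>B | C \<subseteq> B \<and> B \<subseteq> X. g B) = - (\<Sum>B | C \<subseteq> B \<and> B \<subseteq> X. g B)"
    by (simp only: sum_negf)
  then have "2 * (\<Sum>B | C \<subseteq> B \<and> B \<subseteq> X. g B) = 0"
    by (simp only: mult_2 eq_neg_iff_add_eq_0)
  then show ?thesis by simp
qed

lemma signed_sum_descent_families: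
  assumes ord: "irreflp_on {0<..} prec" "transp_on {0<..} prec" "totalp_on {0<..} prec"
    and \<alpha>: "is_composition \<alpha>" and \<gamma>: "comp_le \<gamma> (C_comp prec \<alpha>)"
  shows "(\<Sum>B | ascents prec \<alpha> \<subseteq> B \<and> B \<subseteq> comp_subset \<gamma> \<inter> comp_subset (T_comp prec \<alpha>).
      (-1) ^ card (B - comp_subset \<alpha>) * of_nat (card (descent_families \<alpha> B))) =
    (if comp_le \<alpha> \<gamma> then comp_coeff \<alpha> \<gamma> else 0 :: 'a::field_char_0)"
    (is "sum ?g ?Bs = _")
proof (cases "comp_le \<alpha> \<gamma>")
  case True
  then have sub: "comp_subset \<gamma> \<subseteq> comp_subset \<alpha>" by (simp add: comp_le_iff)
  have "sum ?g ?Bs = (\<Sum>B\<in>?Bs. of_nat (card (descent_families \<alpha> B)))"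
  proof (rule sum.cong[OF refl])
    fix B assume "B \<in> ?Bs"
    then have "B - comp_subset \<alpha> = {}" using sub by blast
    then show "?g B = of_nat (card (descent_families \<alpha> B))"
      by (simp only: card.empty power_0 mult_1)
  qed
  also have "\<dots> = of_nat (card (cut_families \<alpha> (comp_subset \<gamma>)))"
    using \<gamma> sum_card_descent_families[OF ord(1,3) \<alpha> _ sub]
    by (simp add: comp_le_iff comp_subset_C_comp flip: of_nat_sum)
  finally show ?thesis using True by (simp add: comp_coeff_eq_card_cut_families[OF ord True \<gamma>])
next
  case False
  have "is_composition \<gamma>" "sum_list \<gamma> = sum_list \<alpha>"
    using \<gamma> comp_le_C_comp[OF \<alpha>, of prec] by (auto simp: comp_le_iff)
  moreover from this obtain x where x: "x \<in> comp_subset \<gamma>" "x \<notin> comp_subset \<alpha>"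
    using False \<alpha> by (auto simp: comp_le_iff)
  ultimately have x: "x \<in> comp_subset \<gamma>" "x \<notin> comp_subset \<alpha>" "x \<in> {1..<sum_list \<alpha>}"
    using comp_subset_bounds[of \<gamma>] by auto
  have "strict_descents prec \<alpha> \<subseteq> comp_subset \<alpha>" by (auto simp: strict_descents_def comp_subset_def)
  \<comment> \<open>Being no partial sum of \<alpha>, \<open>x\<close> is not a strict descent, so
    toggling it does not leave the range allowed by \<open>T_comp\<close>.\<close>
  then have xT: "x \<in> comp_subset (T_comp prec \<alpha>)" using x by (auto simp: T_comp(3)[OF \<alpha>])
  have "sum ?g ?Bs = 0"
  proof (rule sum_toggle_zero)
    show "x \<in> comp_subset \<gamma> \<inter> comp_subset (T_comp prec \<alpha>)" using x xT by simp
    show "x \<notin> ascents prec \<alpha>" using x ascents_subset by blast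
    fix B assume B: "x \<notin> B" "B \<subseteq> comp_subset \<gamma> \<inter> comp_subset (T_comp prec \<alpha>)"
    then have "finite B" using finite_subset[OF B(2)] by simp
    moreover have "insert x B - comp_subset \<alpha> = insert x (B - comp_subset \<alpha>)" using x by blast
    moreover have "descent_families \<alpha> (insert x B) = descent_families \<alpha> B"
      using x by (intro descent_families_cong) auto
    ultimately show "?g (insert x B) = - ?g B" using B(1) by simp
  qed
  with False show ?thesis by simp
qed

text \<open>The coefficient of the monomial function of \<gamma> in the fundamental expansion. The
  bijection between compositions and subsets turns it into the signed sum over sets.\<close>

lemma sum_SDR_over_coarsenings:
  assumes ord: "irreflp_on {0<..} prec" "transp_on {0<..} prec" "totalp_on {0<..} prec"
    and \<alpha>: "is_composition \<alpha>" and \<gamma>: "comp_le \<gamma> (C_comp prec \<alpha>)"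
  shows "(\<Sum>\<beta> | (comp_le (T_comp prec \<alpha>) \<beta> \<and> comp_le \<beta> (C_comp prec \<alpha>)) \<and> comp_le \<gamma> \<beta>.
      (-1) powi ribbon_ht \<beta> \<alpha> * of_nat (card (SDR \<beta> \<alpha>))) =
    (if comp_le \<alpha> \<gamma> then comp_coeff \<alpha> \<gamma> else 0 :: 'a::field_char_0)"
    (is "sum ?w ?\<B> = _")
proof -
  let ?g = "\<lambda>B. (-1) ^ card (B - comp_subset \<alpha>) * of_nat (card (descent_families \<alpha> B)) :: 'a"
  have C: "is_composition (C_comp prec \<alpha>)" "sum_list (C_comp prec \<alpha>) = sum_list \<alpha>"
    using comp_le_C_comp[OF \<alpha>, of prec] by (auto simp: comp_le_iff)
  note T = T_comp[OF \<alpha>, of prec]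
  have \<gamma>': "is_composition \<gamma>" "sum_list \<gamma> = sum_list \<alpha>" using \<gamma> C by (auto simp: comp_le_iff)
  have \<B>: "\<beta> \<in> ?\<B> \<longleftrightarrow> is_composition \<beta> \<and> sum_list \<beta> = sum_list \<alpha> \<and> ascents prec \<alpha> \<subseteq> comp_subset \<beta> \<and>
      comp_subset \<beta> \<subseteq> comp_subset \<gamma> \<inter> comp_subset (T_comp prec \<alpha>)" for \<beta>
    using C T(1,2) \<gamma>' by (auto simp: comp_le_iff comp_subset_C_comp)
  have "sum ?w ?\<B> = (\<Sum>\<beta>\<in>?\<B>. ?g (comp_subset \<beta>))"
    using \<alpha> \<B> by (intro sum.cong) (simp_all add: ribbon_ht_eq card_SDR)
  also have "\<dots> = (\<Sum>B | ascents prec \<alpha> \<subseteq> B \<and> B \<subseteq> comp_subset \<gamma> \<inter> comp_subset (T_comp prec \<alpha>). ?g B)"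
  proof (rule sum.reindex_bij_betw, rule bij_betw_imageI)
    show "inj_on comp_subset ?\<B>"
      using \<B> by (intro inj_onI comp_subset_inject) auto
    show "comp_subset ` ?\<B> = {B. ascents prec \<alpha> \<subseteq> B \<and> B \<subseteq> comp_subset \<gamma> \<inter> comp_subset (T_comp prec \<alpha>)}"
    proof (intro equalityI subsetI)
      fix B assume B: "B \<in> {B. ascents prec \<alpha> \<subseteq> B \<and> B \<subseteq> comp_subset \<gamma> \<inter> comp_subset (T_comp prec \<alpha>)}"
      then have "B \<subseteq> {1..<sum_list \<alpha>}" using comp_subset_bounds[OF \<gamma>'(1)] \<gamma>'(2) by auto
      from composition_of_subset_exists[OF this] obtain \<beta> where
        "is_composition \<beta>" "sum_list \<beta> = sum_list \<alpha>" "comp_subset \<beta> = B" by blast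
      moreover from this B have "\<beta> \<in> ?\<B>" by (intro \<B>[THEN iffD2]) simp
      ultimately show "B \<in> comp_subset ` ?\<B>" by blast
    qed (use \<B> in auto)
  qed
  also note signed_sum_descent_families[OF ord \<alpha> \<gamma>]
  finally show ?thesis .
qed

theorem theorem6:
  fixes prec :: "nat \<Rightarrow> nat \<Rightarrow> bool" and \<alpha> :: "nat list"
  assumes "irreflp_on {0<..} prec" and "transp_on {0<..} prec" and "totalp_on {0<..} prec"
    and "is_composition \<alpha>"
  shows "(powersum_qsym prec \<alpha> :: 'a::field_char_0 power_series) =
    (\<lambda>m. \<Sum>\<beta> | comp_le (T_comp prec \<alpha>) \<beta> \<and> comp_le \<beta> (C_comp prec \<alpha>).
       (-1) powi ribbon_ht \<beta> \<alpha> * of_nat (card (SDR \<beta> \<alpha>)) * fundamental_qsym \<beta> m)"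
proof
  fix m :: "nat \<Rightarrow>\<^sub>0 nat"
  let ?\<B> = "{\<beta>. comp_le (T_comp prec \<alpha>) \<beta> \<and> comp_le \<beta> (C_comp prec \<alpha>)}"
  let ?\<G> = "{\<gamma>. comp_le \<gamma> (C_comp prec \<alpha>)}"
  let ?w = "\<lambda>\<beta>. (-1) powi ribbon_ht \<beta> \<alpha> * of_nat (card (SDR \<beta> \<alpha>)) :: 'a"
  let ?M = "\<lambda>\<gamma>. monomial_qsym \<gamma> m :: 'a"
  have finG: "finite ?\<G>"
    by (rule finite_subset[OF _ finite_compositions[of "sum_list (C_comp prec \<alpha>)"]])
      (auto simp: comp_le_iff)
  then have finB: "finite ?\<B>" by (rule finite_subset[rotated]) auto
  have "(\<Sum>\<beta>\<in>?\<B>. ?w \<beta> * fundamental_qsym \<beta> m) = (\<Sum>\<beta>\<in>?\<B>. \<Sum>\<gamma> | \<gamma> \<in> ?\<G> \<and> comp_le \<gamma> \<beta>. ?w \<beta> * ?M \<gamma>)"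
  proof (rule sum.cong[OF refl])
    fix \<beta> assume "\<beta> \<in> ?\<B>"
    \<comment> \<open>Every refinement of \<beta> also refines \<open>C_comp prec \<alpha>\<close>,
      so both sums can range over index sets independent of each other before they are
      exchanged.\<close>
    then have "{\<gamma>. \<gamma> \<in> ?\<G> \<and> comp_le \<gamma> \<beta>} = {\<gamma>. comp_le \<gamma> \<beta>}"
      by (auto simp: comp_le_iff)
    then show "?w \<beta> * fundamental_qsym \<beta> m = (\<Sum>\<gamma> | \<gamma> \<in> ?\<G> \<and> comp_le \<gamma> \<beta>. ?w \<beta> * ?M \<gamma>)"
      by (simp add: fundamental_qsym_def sum_distrib_left)
  qed
  also have "\<dots> = (\<Sum>\<gamma>\<in>?\<G>. \<Sum>\<beta> | \<beta> \<in> ?\<B> \<and> comp_le \<gamma> \<beta>. ?w \<beta> * ?M \<gamma>)"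
    using finB finG by (rule sum.swap_restrict)
  also have "\<dots> = (\<Sum>\<gamma>\<in>?\<G>. if comp_le \<alpha> \<gamma> then comp_coeff \<alpha> \<gamma> * ?M \<gamma> else 0)"
  proof (rule sum.cong[OF refl])
    fix \<gamma> assume "\<gamma> \<in> ?\<G>"
    then have "sum ?w {\<beta>. \<beta> \<in> ?\<B> \<and> comp_le \<gamma> \<beta>} = (if comp_le \<alpha> \<gamma> then comp_coeff \<alpha> \<gamma> else 0)"
      using sum_SDR_over_coarsenings[OF assms, of \<gamma>] by simp
    then show "(\<Sum>\<beta> | \<beta> \<in> ?\<B> \<and> comp_le \<gamma> \<beta>. ?w \<beta> * ?M \<gamma>) =
        (if comp_le \<alpha> \<gamma> then comp_coeff \<alpha> \<gamma> * ?M \<gamma> else 0)"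
      by (simp flip: sum_distrib_right)
  qed
  also have "\<dots> = (\<Sum>\<gamma> | \<gamma> \<in> ?\<G> \<and> comp_le \<alpha> \<gamma>. comp_coeff \<alpha> \<gamma> * ?M \<gamma>)"
    using finG by (rule sum.inter_filter[symmetric])
  also have "\<dots> = powersum_qsym prec \<alpha> m"
    by (simp add: powersum_qsym_def conj_commute)
  finally show "powersum_qsym prec \<alpha> m = (\<Sum>\<beta>\<in>?\<B>. ?w \<beta> * fundamental_qsym \<beta> m)" by (rule sym)
qed

end
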